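(* For each of the following trees $T$, with given distinguished adjacent vertices $v$ and $w$, the independent set sequence of $T^n(v,w)$ is log-concave (and so unimodal) for all integers $n \geq 0$. 1. $T=S_{\ell_1,\ell_2}$, where $\ell_1,\ell_2\ge 0$ are arbitrary integers: the double star consisting of adjacent vertices $v$ and $w$, with $v$ having $\ell_1$ neighbors other than $w$, all of them leaves, and $w$ having $\ell_2$ neighbors other than $v$, all of them leaves. (In this case $S_{\ell_1,\ell_2}^n(v,w)$ is a path on $2n$ vertices with $\ell_1$ and $\ell_2$ pendant edges attached alternately at the vertices.) 2. $T=P_k$, the path on $k$ vertices, where $2 \leq k \leq 5000$, with $w$ a leaf and $v$ its unique neighbor. (In this case $P_k^n(v,w)$ is a path on $2n$ vertices with a path of length $k-2$ attached at every second vertex.)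
   Context: All graphs are simple, finite and loopless. An independent set in a graph $H$ is a set of pairwise non-adjacent vertices; $i_H(t)$ is the number of independent sets of size $t$ in $H$, $\alpha(H)$ is the size of the largest independent set, and the independent set sequence of $H$ is $(i_H(t))_{t=0}^{\alpha(H)}$. A finite real sequence $(a_0,\dots,a_n)$ is log-concave if $a_k^2\ge a_{k-1}a_{k+1}$ for $k=1,\dots,n-1$, and unimodal if there is $m$, $0\le m\le n$, with $a_0\le a_1\le\dots\le a_m\ge a_{m+1}\ge\dots\ge a_n$. For a graph $G$ with adjacent distinguished vertices $v,w$, the graph $G^n(v,w)$ (the $n$-concatenation of $G$ through $v$ and $w$) is obtained by taking $n$ vertex-disjoint copies of $G$, with the copies of the distinguished vertices labeled $v_1,w_1,v_2,w_2,\dots,v_n,w_n$, and adding the $n-1$ edges $w_1v_2, w_2v_3,\dots,w_{n-1}v_n$; $G^0(v,w)$ is the graph with no vertices. *)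

theory Defs
  imports Complex_Main "Graph_Theory.Pair_Digraph"
begin

text \<open>
  A simple graph is a \<^locale>\<open>pair_graph\<close>: a finite, loopless digraph on vertices \<open>pverts G\<close>
  whose arc relation \<open>parcs G\<close> is symmetric, so that every undirected edge is represented by both
  of its orientations.
\<close>

definition independent_set :: "'a pair_pre_digraph \<Rightarrow> 'a set \<Rightarrow> bool" where
  "independent_set H S \<longleftrightarrow> S \<subseteq> pverts H \<and> (\<forall>x\<in>S. \<forall>y\<in>S. (x, y) \<notin> parcs H)"

definition indep_count :: "'a pair_pre_digraph \<Rightarrow> nat \<Rightarrow> nat" where
  "indep_count H t = card {S. independent_set H S \<and> card S = t}"

definition indep_number :: "'a pair_pre_digraph \<Rightarrow> nat" where
  "indep_number H = Max {card S | S. independent_set H S}"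

definition indep_seq :: "'a pair_pre_digraph \<Rightarrow> real list" where
  "indep_seq H = map (\<lambda>t. real (indep_count H t)) [0..<Suc (indep_number H)]"

text \<open>The list \<open>a\<close> stands for the sequence \<open>a ! 0, \<dots>, a ! n\<close> where \<open>length a = n + 1\<close>.\<close>

definition log_concave :: "real list \<Rightarrow> bool" where
  "log_concave a \<longleftrightarrow>
     (\<forall>k. 1 \<le> k \<and> k + 1 < length a \<longrightarrow> (a ! k)\<^sup>2 \<ge> a ! (k - 1) * a ! (k + 1))"

definition unimodal :: "real list \<Rightarrow> bool" where
  "unimodal a \<longleftrightarrow>
     (\<exists>m < length a. (\<forall>i < m. a ! i \<le> a ! (i + 1)) \<and>
        (\<forall>i. m \<le> i \<and> i + 1 < length a \<longrightarrow> a ! i \<ge> a ! (i + 1)))"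

text \<open>
  The vertex \<open>(i, x)\<close>, for \<open>1 \<le> i \<le> n\<close>, is the vertex \<open>x\<close> in the \<open>i\<close>-th copy of \<open>G\<close>.
\<close>

definition concatenation ::
    "nat \<Rightarrow> 'a pair_pre_digraph \<Rightarrow> 'a \<Rightarrow> 'a \<Rightarrow> (nat \<times> 'a) pair_pre_digraph" where
  "concatenation n G v w =
     (let links = {((i, w), (i + 1, v)) | i. 1 \<le> i \<and> i < n}
      in \<lparr> pverts = {1..n} \<times> pverts G,
           parcs = {((i, x), (i, y)) | i x y. i \<in> {1..n} \<and> (x, y) \<in> parcs G}
                     \<union> (links \<union> links\<inverse>) \<rparr>)"

datatype double_star_vertex = Center_v | Center_w | Leaf_v nat | Leaf_w nat

definition double_star :: "nat \<Rightarrow> nat \<Rightarrow> double_star_vertex pair_pre_digraph" where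
  "double_star l1 l2 =
     (let E = {(Center_v, Center_w)} \<union> {(Center_v, Leaf_v i) | i. i < l1}
                \<union> {(Center_w, Leaf_w i) | i. i < l2}
      in \<lparr> pverts = {Center_v, Center_w} \<union> Leaf_v ` {..<l1} \<union> Leaf_w ` {..<l2},
           parcs = E \<union> E\<inverse> \<rparr>)"

definition path_graph :: "nat \<Rightarrow> nat pair_pre_digraph" where
  "path_graph k =
     (let E = {(i, i + 1) | i. 1 \<le> i \<and> i < k}
      in \<lparr> pverts = {1..k}, parcs = E \<union> E\<inverse> \<rparr>)"

text \<open>In a symmetric digraph the out-degree is the degree of the underlying graph.\<close>

definition is_leaf :: "'a pair_pre_digraph \<Rightarrow> 'a \<Rightarrow> bool" where
  "is_leaf G x \<longleftrightarrow> x \<in> pverts G \<and> out_degree (with_proj G) x = 1"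

lemma pair_graphI:
  assumes "finite (pverts G)" "parcs G \<subseteq> pverts G \<times> pverts G" "sym (parcs G)" "irrefl (parcs G)"
  shows "pair_graph G"
proof
  show "finite (parcs G)"
    using assms(1,2) by (meson finite_SigmaI finite_subset)
  show "symmetric (with_proj G)"
    using assms(3) by (simp add: symmetric_def)
qed (use assms in \<open>auto simp: irrefl_def\<close>)

lemma pair_graph_double_star: "pair_graph (double_star l1 l2)"
  by (rule pair_graphI) (auto simp: double_star_def Let_def sym_def irrefl_def)

lemma pair_graph_path_graph: "pair_graph (path_graph k)"
  by (rule pair_graphI) (auto simp: path_graph_def Let_def sym_def irrefl_def)

lemma pair_graph_concatenation:
  assumes "pair_graph G" "v \<in> pverts G" "w \<in> pverts G"
  shows "pair_graph (concatenation n G v w)"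
proof -
  interpret pair_graph G by fact
  have "sym (parcs G)"
    using pair_sym_arcs by (simp add: symmetric_def)
  moreover have "(x, x) \<notin> parcs G" for x
    using pair_no_loops by fastforce
  ultimately show ?thesis
    using assms(2,3)
    by (intro pair_graphI)
      (auto simp: concatenation_def Let_def sym_def irrefl_def dest: in_arcsD1 in_arcsD2)
qed

lemma center_adjacent: "(Center_v, Center_w) \<in> parcs (double_star l1 l2)"
  by (simp add: double_star_def Let_def)

lemma is_leaf_path_graph:
  assumes "2 \<le> k"
  shows "is_leaf (path_graph k) k" "(k - 1, k) \<in> parcs (path_graph k)"
proof -
  have "out_arcs (with_proj (path_graph k)) k = {(k, k - 1)}"
    using assms by (auto simp: out_arcs_def path_graph_def Let_def)
  then show "is_leaf (path_graph k) k"
    using assms by (simp add: is_leaf_def out_degree_def path_graph_def Let_def)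
  show "(k - 1, k) \<in> parcs (path_graph k)"
    using assms by (auto simp: path_graph_def Let_def)
qed

end

theory Submission
  imports Defs "HOL-Computational_Algebra.Polynomial"
begin

text \<open>
  Let \<open>p\<^sub>n\<close> be the independence polynomial of the concatenation \<open>G\<^sup>n\<close>, let \<open>g\<close> be that of \<open>G\<close>, and let \<open>h\<close> be the
  product of the generating polynomials of the independent sets of \<open>G\<close> through \<open>v\<close> and through \<open>w\<close>.
  Since \<open>v\<close> and \<open>w\<close> are adjacent, \<open>p\<^sub>n\<^sub>+\<^sub>2 = g p\<^sub>n\<^sub>+\<^sub>1 - h p\<^sub>n\<close>, so \<open>p\<^sub>n\<close> is, up to a factor \<open>g\<close>, the product of the
  polynomials \<open>g\<^sup>2 - c h\<close> with \<open>c = 4 cos\<^sup>2 (j pi / (n + 1))\<close> and \<open>j \<le> n / 2\<close>. Products of log-concave polynomials are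
  log-concave, so it suffices that \<open>g\<^sup>2 - c h\<close> is log-concave for \<open>0 \<le> c \<le> 4\<close>. This fails only for
  \<open>P\<^sub>3\<close> (which is a double star) and \<open>P\<^sub>5\<close> with \<open>c\<close> close to 4; there every factor with \<open>c > 3\<close> is paired with one
  with \<open>c \<le> 1\<close>.

  For double stars \<open>g\<^sup>2 - c h\<close> is, up to a power of \<open>1 + x\<close>, a square whose coefficients satisfy the
  inequality \<open>(i + 1) a\<^sub>i\<^sub>-\<^sub>1 a\<^sub>i\<^sub>+\<^sub>1 \<le> i a\<^sub>i\<^sup>2\<close>, plus a perturbation that is negligible unless the star is small.
  For paths, up to corrections in the leading coefficients, the polynomials \<open>g\<^sup>2 - c h\<close> and
  their analogues for products of consecutive path polynomials satisfy \<open>q\<^sub>k\<^sub>+\<^sub>1 = q\<^sub>k + x q\<^sub>k\<^sub>-\<^sub>1\<close>, and this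
  recurrence preserves log-concavity together with an interlacing condition on the coefficient ratios.
\<close>

section \<open>Log-concave polynomials\<close>

text \<open>Allowing arbitrary gaps \<open>b\<close> and \<open>e\<close>, and not only neighbouring
  coefficients, also excludes internal zeros. This total positivity of order two is closed under
  products; the adjacent inequality alone is not.\<close>

definition logc :: "real poly \<Rightarrow> bool" where
  "logc p \<longleftrightarrow> (\<forall>i. 0 \<le> coeff p i) \<and>
     (\<forall>a b e. coeff p a * coeff p (a + b + e) \<le> coeff p (a + b) * coeff p (a + e))"

text \<open>The ratios of the coefficients of \<open>f\<close> to those of \<open>g\<close> are
  nonincreasing, cross-multiplied so that zero coefficients do no harm.\<close>

definition ratio_le :: "real poly \<Rightarrow> real poly \<Rightarrow> bool" where
  "ratio_le f g \<longleftrightarrow> (\<forall>r s. r < s \<longrightarrow> coeff f s * coeff g r \<le> coeff f r * coeff g s)"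

lemma logc_nonneg: "logc p \<Longrightarrow> 0 \<le> coeff p i"
  by (simp add: logc_def)

lemma logcD: "logc p \<Longrightarrow> coeff p a * coeff p (a + b + e) \<le> coeff p (a + b) * coeff p (a + e)"
  by (simp add: logc_def)

text \<open>The Cauchy-Binet identity for two rows. The double sum runs over ordered pairs, so each
  product of minors occurs twice.\<close>

lemma sum_cauchy_binet:
  fixes u u' v v' :: "'a \<Rightarrow> real"
  shows "2 * ((\<Sum>r\<in>A. u r * v r) * (\<Sum>s\<in>A. u' s * v' s)
              - (\<Sum>r\<in>A. u' r * v r) * (\<Sum>s\<in>A. u s * v' s))
    = (\<Sum>r\<in>A. \<Sum>s\<in>A. (u r * u' s - u s * u' r) * (v r * v' s - v s * v' r))"
proof -
  let ?S = "\<lambda>f. \<Sum>r\<in>A. \<Sum>s\<in>A. f r s"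
  have sw: "?S (\<lambda>r s. f s r) = ?S f" for f :: "'a \<Rightarrow> 'a \<Rightarrow> real"
    by (rule sum.swap)
  define P where "P = ?S (\<lambda>r s. u r * v r * (u' s * v' s))"
  define Q where "Q = ?S (\<lambda>r s. u' r * v r * (u s * v' s))"
  have "?S (\<lambda>r s. (u r * u' s - u s * u' r) * (v r * v' s - v s * v' r))
      = ?S (\<lambda>r s. u r * v r * (u' s * v' s)) + ?S (\<lambda>r s. u s * v s * (u' r * v' r))
        - ?S (\<lambda>r s. u' r * v r * (u s * v' s)) - ?S (\<lambda>r s. u' s * v s * (u r * v' r))"
    by (simp add: sum.distrib[symmetric] sum_subtractf[symmetric] algebra_simps)
  also have "\<dots> = P + P - Q - Q"
    unfolding P_def Q_def
    using sw[of "\<lambda>r s. u r * v r * (u' s * v' s)"] sw[of "\<lambda>r s. u' r * v r * (u s * v' s)"] by simp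
  finally show ?thesis
    by (simp add: P_def Q_def sum_product)
qed

text \<open>Multiplication by \<open>g\<close> applies the Toeplitz matrix of \<open>g\<close> to
  the rows \<open>f\<close> and \<open>f'\<close>. Log-concavity of \<open>g\<close> makes the
  relevant minors of that matrix nonnegative, so Cauchy-Binet preserves the sign.\<close>

lemma ratio_le_mult:
  assumes "ratio_le f f'" "logc g"
  shows "ratio_le (f * g) (f' * g)"
  unfolding ratio_le_def
proof (intro allI impI)
  fix j k :: nat
  assume "j < k"
  \<comment> \<open>The Toeplitz matrix of \<open>g\<close>; the guard keeps truncated subtraction
    from creating spurious entries.\<close>
  define w where "w i r = (if r \<le> i then coeff g (i - r) else 0)" for i r
  have cf: "coeff (h * g) i = (\<Sum>r\<le>k. w i r * coeff h r)" if "i \<le> k" for h i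
  proof -
    have "(\<Sum>r\<le>k. w i r * coeff h r) = (\<Sum>r\<le>i. w i r * coeff h r)"
      using that by (intro sum.mono_neutral_right) (auto simp: w_def)
    also have "\<dots> = coeff (h * g) i"
      unfolding coeff_mult by (intro sum.cong) (auto simp: w_def)
    finally show ?thesis by simp
  qed
  have w: "w j s * w k r \<le> w j r * w k s" if "r \<le> s" for r s
  proof (cases "s \<le> j")
    case True
    have "coeff g (j - s) * coeff g ((j - s) + (s - r) + (k - j))
        \<le> coeff g ((j - s) + (s - r)) * coeff g ((j - s) + (k - j))"
      by (rule logcD) fact
    then show ?thesis using True that \<open>j < k\<close> by (simp add: w_def)
  next
    case False
    then show ?thesis using logc_nonneg[OF assms(2)] by (simp add: w_def)
  qed
  have f: "coeff f s * coeff f' r \<le> coeff f r * coeff f' s" if "r \<le> s" for r s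
    using assms(1) that by (cases "r = s") (auto simp: ratio_le_def)
  \<comment> \<open>Exchanging \<open>r\<close> and \<open>s\<close> flips the sign of both minors,
    so the case \<open>r \<le> s\<close> decides.\<close>
  have "0 \<le> (w j r * w k s - w j s * w k r) * (coeff f r * coeff f' s - coeff f s * coeff f' r)" for r s
  proof (cases "r \<le> s")
    case True
    then show ?thesis using w[of r s] f[of r s] by simp
  next
    case False
    then have "(w j s * w k r - w j r * w k s) * (coeff f s * coeff f' r - coeff f r * coeff f' s) \<ge> 0"
      using w[of s r] f[of s r] by simp
    then show ?thesis by (simp add: algebra_simps)
  qed
  then have "0 \<le> 2 * ((\<Sum>r\<le>k. w j r * coeff f r) * (\<Sum>s\<le>k. w k s * coeff f' s)
              - (\<Sum>r\<le>k. w k r * coeff f r) * (\<Sum>s\<le>k. w j s * coeff f' s))"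
    unfolding sum_cauchy_binet by (intro sum_nonneg)
  then show "coeff (f * g) k * coeff (f' * g) j \<le> coeff (f * g) j * coeff (f' * g) k"
    using \<open>j < k\<close> by (simp add: cf)
qed

text \<open>The defining inequality of \<open>logc\<close> with gap \<open>b\<close>, read as a
  comparison of \<open>p\<close> with its shift; this is the form to which
  \<open>ratio_le_mult\<close> applies.\<close>

lemma logc_ratio_le_monom: "logc p \<Longrightarrow> ratio_le p (monom 1 b * p)"
  unfolding ratio_le_def
proof (intro allI impI)
  fix r s :: nat
  assume p: "logc p" and "r < s"
  show "coeff p s * coeff (monom 1 b * p) r \<le> coeff p r * coeff (monom 1 b * p) s"
  proof (cases "b \<le> r")
    case True
    have "coeff p (r - b) * coeff p ((r - b) + b + (s - r)) \<le> coeff p ((r - b) + b) * coeff p ((r - b) + (s - r))"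
      by (rule logcD[OF p])
    then show ?thesis using True \<open>r < s\<close> by (simp add: coeff_monom_mult mult.commute[of "coeff p s"])
  next
    case False
    then show ?thesis using logc_nonneg[OF p] by (simp add: coeff_monom_mult)
  qed
qed

lemma coeff_mult_nonneg:
  fixes p q :: "real poly"
  assumes "\<And>i. 0 \<le> coeff p i" "\<And>i. 0 \<le> coeff q i"
  shows "0 \<le> coeff (p * q) i"
  using assms by (simp add: coeff_mult sum_nonneg)

text \<open>Shifting one factor shifts the product, so it suffices to multiply the comparison of
  \<open>p\<close> with its shift by \<open>q\<close>.\<close>

lemma logc_mult:
  assumes "logc p" "logc q"
  shows "logc (p * q)"
  unfolding logc_def
proof (intro conjI allI)
  show "0 \<le> coeff (p * q) i" for i
    using assms by (intro coeff_mult_nonneg logc_nonneg)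
  fix a b e
  have r: "ratio_le (p * q) (monom 1 b * p * q)"
    using assms by (intro ratio_le_mult logc_ratio_le_monom)
  show "coeff (p * q) a * coeff (p * q) (a + b + e) \<le> coeff (p * q) (a + b) * coeff (p * q) (a + e)"
  proof (cases "e = 0")
    case False
    then have "coeff (p * q) (a + b + e) * coeff (monom 1 b * p * q) (a + b)
        \<le> coeff (p * q) (a + b) * coeff (monom 1 b * p * q) (a + b + e)"
      using r unfolding ratio_le_def by simp
    then show ?thesis by (simp add: coeff_monom_mult mult.assoc mult.commute[of "coeff (p * q) a"])
  qed (simp add: mult.commute)
qed

lemma logc_one: "logc 1"
  by (auto simp: logc_def one_pCons coeff_pCons split: nat.splits)

lemma logc_prod: "(\<And>i. i \<in> A \<Longrightarrow> logc (f i)) \<Longrightarrow> logc (\<Prod>i\<in>A. f i)"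
  by (induction A rule: infinite_finite_induct) (auto intro: logc_mult logc_one)

lemma logc_power: "logc p \<Longrightarrow> logc (p ^ n)"
  by (induction n) (auto intro: logc_mult logc_one)

text \<open>Below \<open>n\<close> strict positivity allows division and so the chaining of adjacent
  inequalities. Coefficient \<open>n\<close> may vanish, because the degree of the path factors
  depends on parity.\<close>

lemma logcI:
  fixes p :: "real poly"
  assumes pos: "\<And>i. i < n \<Longrightarrow> 0 < coeff p i" and top: "0 \<le> coeff p n"
    and zero: "\<And>i. n < i \<Longrightarrow> coeff p i = 0"
    and adj: "\<And>i. i + 2 \<le> n \<Longrightarrow> coeff p i * coeff p (i + 2) \<le> (coeff p (i + 1))\<^sup>2"
  shows "logc p"
proof -
  have nn: "0 \<le> coeff p i" for i
    using pos[of i] top zero[of i] by (cases i n rule: linorder_cases) auto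
  \<comment> \<open>The case of gap one, by chaining in \<open>e\<close>; general gaps then follow
    by induction on \<open>b\<close>.\<close>
  have 1: "coeff p a * coeff p (a + 1 + e) \<le> coeff p (a + 1) * coeff p (a + e)" for a e
  proof (induction e)
    case (Suc e)
    show ?case
    proof (cases "a + e + 2 \<le> n")
      case True
      have p: "0 < coeff p (a + e)" using True by (intro pos) simp
      have "coeff p a * coeff p (a + e + 2) * coeff p (a + e) \<le> coeff p a * (coeff p (a + e + 1))\<^sup>2"
        using mult_left_mono[OF adj[OF True] nn[of a]] by (simp add: mult_ac)
      also have "\<dots> = (coeff p a * coeff p (a + 1 + e)) * coeff p (a + e + 1)"
        by (simp add: power2_eq_square mult_ac add_ac)
      also have "\<dots> \<le> (coeff p (a + 1) * coeff p (a + e)) * coeff p (a + e + 1)"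
        by (rule mult_right_mono[OF Suc.IH nn])
      finally have "coeff p (a + e) * (coeff p a * coeff p (a + e + 2))
          \<le> coeff p (a + e) * (coeff p (a + 1) * coeff p (a + e + 1))"
        by (simp add: mult_ac)
      then have "coeff p a * coeff p (a + e + 2) \<le> coeff p (a + 1) * coeff p (a + e + 1)"
        using p by simp
      then show ?thesis by simp
    next
      case False
      then have "coeff p (a + 1 + Suc e) = 0" by (intro zero) simp
      then show ?thesis using nn by simp
    qed
  qed (simp add: mult.commute)
  have "coeff p a * coeff p (a + b + e) \<le> coeff p (a + b) * coeff p (a + e)" for a b e
  proof (induction b arbitrary: a e)
    case (Suc b)
    show ?case
    proof (cases e)
      case (Suc e')
      have "coeff p a * coeff p (a + 1 + (b + e)) \<le> coeff p (a + 1) * coeff p (a + (b + e))"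
        by (rule 1)
      also have "\<dots> \<le> coeff p (a + Suc b) * coeff p (a + e)"
        using Suc.IH[of "a + 1" e'] Suc by (simp add: add_ac)
      finally show ?thesis by (simp add: add_ac)
    qed (simp add: mult.commute)
  qed (simp)
  with nn show ?thesis by (simp add: logc_def)
qed


text \<open>The mode \<open>m\<close> is the first strict descent, or \<open>n\<close> if there is
  none; after a descent log-concavity forbids an ascent. The positive constant term carries over to
  \<open>coeff p m\<close>, by which the argument divides.\<close>

lemma seq_of_logc:
  assumes p: "logc p" and 0: "0 < coeff p 0"
  shows "log_concave (map (coeff p) [0..<Suc n]) \<and> unimodal (map (coeff p) [0..<Suc n])"
proof
  let ?a = "map (coeff p) [0..<Suc n]"
  have nth: "?a ! i = coeff p i" if "i \<le> n" for i
    using that by (simp del: upt_Suc)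
  show "log_concave ?a"
    unfolding log_concave_def
  proof (intro allI impI)
    fix k
    assume k: "1 \<le> k \<and> k + 1 < length ?a"
    have le: "k - 1 \<le> n" using k by auto
    have "coeff p (k - 1) * coeff p ((k - 1) + 1 + 1) \<le> coeff p ((k - 1) + 1) * coeff p ((k - 1) + 1)"
      by (rule logcD[OF p])
    then show "?a ! (k - 1) * ?a ! (k + 1) \<le> (?a ! k)\<^sup>2"
      using k nth[OF le] nth[of k] nth[of "k + 1"] by (simp add: power2_eq_square del: upt_Suc)
  qed
  define m where "m = (LEAST i. i = n \<or> coeff p (Suc i) < coeff p i)"
  have mn: "m = n \<or> coeff p (Suc m) < coeff p m"
    unfolding m_def by (rule LeastI[of _ n]) simp
  have "m \<le> n"
    unfolding m_def by (rule Least_le) simp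
  have up: "coeff p i \<le> coeff p (Suc i)" if "i < m" for i
    using not_less_Least[of i "\<lambda>i. i = n \<or> coeff p (Suc i) < coeff p i"] that
    by (auto simp: m_def[symmetric])
  have "0 < coeff p i" if "i \<le> m" for i
    using that
  proof (induction i)
    case (Suc i)
    then show ?case using up[of i] by simp
  qed (use 0 in simp)
  then have pos: "0 < coeff p m" by simp
  have down: "coeff p (Suc i) \<le> coeff p i" if "m \<le> i" "i < n" for i
  proof -
    have m: "coeff p (Suc m) \<le> coeff p m" using mn that by auto
    have "coeff p m * coeff p (m + 1 + (i - m)) \<le> coeff p (m + 1) * coeff p (m + (i - m))"
      by (rule logcD[OF p])
    also have "\<dots> \<le> coeff p m * coeff p i"
      using m that logc_nonneg[OF p] by (auto intro: mult_right_mono)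
    finally show ?thesis using pos that by simp
  qed
  show "unimodal ?a"
    unfolding unimodal_def
    using \<open>m \<le> n\<close> up down
    by (intro exI[of _ m]) (auto simp: nth simp del: upt_Suc)
qed

section \<open>Ultra-log-concave polynomials\<close>

text \<open>For positive coefficients the second conjunct says that
  \<open>fact i * coeff p i\<close> is a log-concave sequence. Phrased with \<open>pderiv\<close>,
  it passes to products by the Leibniz rule.\<close>

definition ulogc :: "real poly \<Rightarrow> bool" where
  "ulogc p \<longleftrightarrow> logc p \<and> ratio_le (pderiv p) p"

lemma ratio_le_add: "ratio_le f h \<Longrightarrow> ratio_le g h \<Longrightarrow> ratio_le (f + g) h"
  unfolding ratio_le_def by (auto simp: algebra_simps intro!: add_mono)

text \<open>Each summand of the Leibniz rule is \<open>ratio_le\<close> the product, by multiplying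
  the hypothesis on one factor by the other factor, and \<open>ratio_le\<close> is additive on the
  left.\<close>

lemma ulogc_mult:
  assumes "ulogc p" "ulogc q"
  shows "ulogc (p * q)"
proof -
  have "ratio_le (pderiv p * q) (p * q)" "ratio_le (pderiv q * p) (q * p)"
    using assms by (auto simp: ulogc_def intro!: ratio_le_mult)
  then show ?thesis
    using assms by (auto simp: ulogc_def pderiv_mult mult.commute add.commute intro!: ratio_le_add logc_mult)
qed

lemma ulogc_one: "ulogc 1"
  by (simp add: ulogc_def logc_one ratio_le_def)

lemma ulogc_power: "ulogc p \<Longrightarrow> ulogc (p ^ n)"
  by (induction n) (auto intro: ulogc_mult ulogc_one)

lemma ulogc_adj:
  assumes "ulogc p"
  shows "real (j + 2) * (coeff p j * coeff p (j + 2)) \<le> real (j + 1) * (coeff p (j + 1))\<^sup>2"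
proof -
  have "coeff (pderiv p) (j + 1) * coeff p j \<le> coeff (pderiv p) j * coeff p (j + 1)"
    using assms by (simp add: ulogc_def ratio_le_def)
  then show ?thesis
    by (simp add: coeff_pderiv power2_eq_square mult_ac)
qed

section \<open>Independence polynomials of concatenations\<close>

text \<open>Families other than all independent sets are needed as well: those through
  \<open>v\<close>, through \<open>w\<close>, and arbitrary subsets of leaves.\<close>

definition setpoly :: "'a set set \<Rightarrow> real poly" where
  "setpoly A = (\<Sum>S\<in>A. monom 1 (card S))"

abbreviation ipoly :: "'a pair_pre_digraph \<Rightarrow> real poly" where
  "ipoly H \<equiv> setpoly {S. independent_set H S}"

lemma coeff_setpoly: "finite A \<Longrightarrow> coeff (setpoly A) t = card {S \<in> A. card S = t}"
  by (simp add: setpoly_def coeff_sum if_distrib sum.If_cases Int_def cong: if_cong)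

lemma setpoly_Un: "finite A \<Longrightarrow> finite B \<Longrightarrow> A \<inter> B = {} \<Longrightarrow> setpoly (A \<union> B) = setpoly A + setpoly B"
  by (simp add: setpoly_def sum.union_disjoint)

lemma setpoly_product:
  assumes "bij_betw f (A \<times> B) C"
    and "\<And>S T. S \<in> A \<Longrightarrow> T \<in> B \<Longrightarrow> card (f (S, T)) = card S + card T"
  shows "setpoly C = setpoly A * setpoly B"
proof -
  have "setpoly C = (\<Sum>ST\<in>A \<times> B. monom 1 (card (f ST)))"
    unfolding setpoly_def using sum.reindex_bij_betw[OF assms(1), of "\<lambda>S. monom (1::real) (card S)"] by simp
  also have "\<dots> = (\<Sum>(S, T)\<in>A \<times> B. monom 1 (card S) * monom 1 (card T))"
    by (intro sum.cong) (auto simp: assms(2) mult_monom)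
  finally show ?thesis
    by (simp add: setpoly_def sum_product sum.cartesian_product)
qed

lemma setpoly_bij:
  assumes "bij_betw f A C" "\<And>S. S \<in> A \<Longrightarrow> card (f S) = card S"
  shows "setpoly C = setpoly A"
  unfolding setpoly_def using sum.reindex_bij_betw[OF assms(1), of "\<lambda>S. monom (1::real) (card S)"] assms(2)
  by simp

lemma setpoly_insert_image:
  assumes "\<And>S. S \<in> A \<Longrightarrow> finite S \<and> x \<notin> S"
  shows "setpoly (insert x ` A) = monom 1 1 * setpoly A"
proof -
  have inj: "inj_on (insert x) A"
    using assms by (metis inj_onI insert_ident)
  have "setpoly (insert x ` A) = (\<Sum>S\<in>A. monom 1 (card (insert x S)))"
    unfolding setpoly_def using sum.reindex[OF inj] by simp
  also have "\<dots> = (\<Sum>S\<in>A. monom 1 1 * monom 1 (card S))"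
    using assms by (intro sum.cong) (auto simp: mult_monom)
  finally show ?thesis by (simp add: setpoly_def sum_distrib_left)
qed

lemma setpoly_Pow: "finite A \<Longrightarrow> setpoly (Pow A) = [:1, 1:] ^ card A"
proof (induction A rule: finite_induct)
  case (insert x A)
  have "setpoly (Pow (insert x A)) = setpoly (Pow A) + monom 1 1 * setpoly (Pow A)"
  proof -
    have "setpoly (insert x ` Pow A) = monom 1 1 * setpoly (Pow A)"
      using insert by (intro setpoly_insert_image) (auto dest: finite_subset)
    then show ?thesis
      unfolding Pow_insert using insert by (subst setpoly_Un) auto
  qed
  also have "\<dots> = [:1, 1:] * setpoly (Pow A)"
    by (simp add: monom_altdef algebra_simps)
  finally show ?case using insert by simp
qed (simp add: setpoly_def)

lemma finite_indep: "finite (pverts H) \<Longrightarrow> finite {S. independent_set H S}"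
  by (rule finite_subset[of _ "Pow (pverts H)"]) (auto simp: independent_set_def)

lemma indep_seq_ipoly:
  assumes "finite (pverts H)"
  shows "indep_seq H = map (coeff (ipoly H)) [0..<Suc (indep_number H)]"
  unfolding indep_seq_def
  by (simp add: coeff_setpoly[OF finite_indep[OF assms]] indep_count_def)

lemma coeff_ipoly_0:
  assumes "finite (pverts H)"
  shows "coeff (ipoly H) 0 = 1"
proof -
  have "{S \<in> {S. independent_set H S}. card S = 0} = {{}}"
    using assms by (auto simp: independent_set_def dest: finite_subset)
  then show ?thesis by (simp add: coeff_setpoly[OF finite_indep[OF assms]])
qed

locale concat_graph =
  fixes G :: "'a pair_pre_digraph" and v w :: 'a
  assumes fin: "finite (pverts G)" and irr: "\<And>x. (x, x) \<notin> parcs G"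
    and vw: "(v, w) \<in> parcs G"
begin

abbreviation "cc n \<equiv> concatenation n G v w"
abbreviation "Ind n \<equiv> {S. independent_set (cc n) S}"

definition join :: "nat \<Rightarrow> (nat \<times> 'a) set \<times> 'a set \<Rightarrow> (nat \<times> 'a) set" where
  "join n ST = fst ST \<union> Pair (Suc n) ` snd ST"

lemma fin_cc: "finite (pverts (cc n))"
  by (simp add: concatenation_def Let_def fin)

lemma indep_cc:
  "independent_set (cc n) S \<longleftrightarrow> S \<subseteq> {1..n} \<times> pverts G \<and>
     (\<forall>i x y. (i, x) \<in> S \<longrightarrow> (i, y) \<in> S \<longrightarrow> (x, y) \<notin> parcs G) \<and>
     (\<forall>i. (i, w) \<in> S \<longrightarrow> (i + 1, v) \<in> S \<longrightarrow> False)"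
  (is "_ \<longleftrightarrow> ?sub \<and> ?copies \<and> ?links")
proof -
  have V: "pverts (cc n) = {1..n} \<times> pverts G"
    by (simp add: concatenation_def Let_def)
  have E: "(p, q) \<in> parcs (cc n) \<longleftrightarrow>
      (fst p = fst q \<and> fst p \<in> {1..n} \<and> (snd p, snd q) \<in> parcs G) \<or>
      (snd p = w \<and> snd q = v \<and> fst q = fst p + 1 \<and> 1 \<le> fst p \<and> fst p < n) \<or>
      (snd q = w \<and> snd p = v \<and> fst p = fst q + 1 \<and> 1 \<le> fst q \<and> fst q < n)" for p q
    by (cases p, cases q) (auto simp: concatenation_def Let_def)
  show ?thesis
  proof
    assume I: "independent_set (cc n) S"
    then have S: ?sub by (simp add: independent_set_def V)
    have no: "(p, q) \<notin> parcs (cc n)" if "p \<in> S" "q \<in> S" for p q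
      using I that by (simp add: independent_set_def)
    have "(x, y) \<notin> parcs G" if "(i, x) \<in> S" "(i, y) \<in> S" for i x y
      using no[OF that] S that by (auto simp: E)
    moreover have False if "(i, w) \<in> S" "(i + 1, v) \<in> S" for i
    proof -
      have "i \<in> {1..n}" "i + 1 \<in> {1..n}" using S that by blast+
      then show False using no[OF that] by (auto simp: E)
    qed
    ultimately show "?sub \<and> ?copies \<and> ?links" using S by blast
  next
    assume R: "?sub \<and> ?copies \<and> ?links"
    have "(p, q) \<notin> parcs (cc n)" if "p \<in> S" "q \<in> S" for p q
    proof
      assume "(p, q) \<in> parcs (cc n)"
      then consider "fst p = fst q" "(snd p, snd q) \<in> parcs G"
        | "p = (fst p, w)" "q = (fst p + 1, v)" | "q = (fst q, w)" "p = (fst q + 1, v)"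
        unfolding E by (metis prod.collapse)
      then show False
        using R that by cases (metis prod.collapse)+
    qed
    then show "independent_set (cc n) S"
      using R by (simp add: independent_set_def V)
  qed
qed

text \<open>The only edge between the first \<open>n\<close> copies and the new one joins
  \<open>w\<close> of copy \<open>n\<close> to \<open>v\<close> of copy
  \<open>n + 1\<close>.\<close>

lemma join_indep:
  assumes "S \<in> Ind n" "independent_set G T"
  shows "join n (S, T) \<in> Ind (Suc n) \<longleftrightarrow> \<not> ((n, w) \<in> S \<and> v \<in> T)"
proof -
  have S: "S \<subseteq> {1..n} \<times> pverts G" and T: "T \<subseteq> pverts G"
    using assms by (auto simp: indep_cc independent_set_def[of G])
  have S1: "\<And>i x y. (i, x) \<in> S \<Longrightarrow> (i, y) \<in> S \<Longrightarrow> (x, y) \<notin> parcs G"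
    and S2: "\<And>i. (i, w) \<in> S \<Longrightarrow> (i + 1, v) \<notin> S"
    using assms(1) by (auto simp: indep_cc)
  have T1: "\<And>x y. x \<in> T \<Longrightarrow> y \<in> T \<Longrightarrow> (x, y) \<notin> parcs G"
    using assms(2) by (auto simp: independent_set_def)
  have mem: "(i, x) \<in> join n (S, T) \<longleftrightarrow> (if i = Suc n then x \<in> T else (i, x) \<in> S)" for i x
    using S by (auto simp: join_def)
  have out: "(Suc (Suc n), x) \<notin> S" for x
    using S by auto
  have sub: "join n (S, T) \<subseteq> {1..Suc n} \<times> pverts G"
    using S T by (auto simp: join_def)
  have copies: "(x, y) \<notin> parcs G" if "(i, x) \<in> join n (S, T)" "(i, y) \<in> join n (S, T)" for i x y
    using that S1 T1 by (auto simp: mem split: if_splits)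
  have links: "(\<exists>i. (i, w) \<in> join n (S, T) \<and> (i + 1, v) \<in> join n (S, T)) \<longleftrightarrow> (n, w) \<in> S \<and> v \<in> T"
    (is "?l = ?r")
  proof
    assume ?l
    then show ?r using S2 out by (auto simp: mem split: if_splits)
  next
    assume ?r
    then show ?l by (intro exI[of _ n]) (simp add: mem)
  qed
  show ?thesis
    unfolding mem_Collect_eq indep_cc using sub copies links by blast
qed

lemma card_join:
  assumes "S \<in> Ind n" "independent_set G T"
  shows "card (join n (S, T)) = card S + card T"
proof -
  have S: "S \<subseteq> {1..n} \<times> pverts G" and T: "T \<subseteq> pverts G"
    using assms by (auto simp: indep_cc independent_set_def[of G])
  have "finite S" "finite T"
    using S T fin by (auto intro: finite_subset)
  moreover have "S \<inter> Pair (Suc n) ` T = {}" using S by auto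
  ultimately show ?thesis
    by (simp add: join_def card_Un_disjoint card_image inj_on_def)
qed

lemma inj_join: "inj_on (join n) (Ind n \<times> {T. independent_set G T})"
proof (rule inj_onI)
  fix p q
  assume p: "p \<in> Ind n \<times> {T. independent_set G T}" and q: "q \<in> Ind n \<times> {T. independent_set G T}"
    and e: "join n p = join n q"
  have "fst r = {z \<in> join n r. fst z \<noteq> Suc n} \<and> snd r = {x. (Suc n, x) \<in> join n r}"
    if "r \<in> Ind n \<times> {T. independent_set G T}" for r
    using that by (auto simp: join_def indep_cc)
  from this[OF p] this[OF q] e show "p = q" by (metis prod_eqI)
qed

lemma join_surj:
  assumes "U \<in> Ind (Suc n)"
  obtains S T where "S \<in> Ind n" "independent_set G T" "U = join n (S, T)" "(n, w) \<in> S \<longrightarrow> v \<notin> T"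
proof
  let ?S = "{z \<in> U. fst z \<noteq> Suc n}" and ?T = "{x. (Suc n, x) \<in> U}"
  have U: "U \<subseteq> {1..Suc n} \<times> pverts G" using assms by (simp add: indep_cc)
  show "?S \<in> Ind n"
    using assms U unfolding mem_Collect_eq indep_cc by (auto simp: le_Suc_eq)
  show "independent_set G ?T"
    using assms U by (auto simp: indep_cc independent_set_def[of G])
  show "U = join n (?S, ?T)"
    by (auto simp: join_def)
  show "(n, w) \<in> ?S \<longrightarrow> v \<notin> ?T"
    using assms by (auto simp: indep_cc)
qed

abbreviation "Iv \<equiv> {T. independent_set G T \<and> v \<in> T}"
abbreviation "Iw \<equiv> {T. independent_set G T \<and> w \<in> T}"

lemma ipoly_0: "ipoly (cc 0) = 1"
proof -
  have "Ind 0 = {{}}" by (auto simp: indep_cc)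
  then show ?thesis by (simp add: setpoly_def)
qed

text \<open>A set containing \<open>w\<close> in the last copy avoids its neighbour \<open>v\<close>
  there, so the link to the previous copy imposes nothing and the first \<open>n\<close> copies are
  free.\<close>

lemma w_last: "setpoly {S \<in> Ind (Suc n). (Suc n, w) \<in> S} = ipoly (cc n) * setpoly Iw"
proof (rule setpoly_product[where f = "join n"])
  have v: "v \<notin> T" if "T \<in> Iw" for T
    using that vw by (auto simp: independent_set_def)
  show "bij_betw (join n) (Ind n \<times> Iw) {S \<in> Ind (Suc n). (Suc n, w) \<in> S}"
    unfolding bij_betw_def
  proof
    show "inj_on (join n) (Ind n \<times> Iw)"
      by (rule inj_on_subset[OF inj_join]) auto
    show "join n ` (Ind n \<times> Iw) = {S \<in> Ind (Suc n). (Suc n, w) \<in> S}"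
    proof (intro equalityI subsetI)
      fix U assume "U \<in> join n ` (Ind n \<times> Iw)"
      then obtain S T where ST: "S \<in> Ind n" "T \<in> Iw" "U = join n (S, T)" by auto
      then show "U \<in> {S \<in> Ind (Suc n). (Suc n, w) \<in> S}"
        using v[OF ST(2)] join_indep[of S n T] by (auto simp: join_def)
    next
      fix U assume U: "U \<in> {S \<in> Ind (Suc n). (Suc n, w) \<in> S}"
      then obtain S T where ST: "S \<in> Ind n" "independent_set G T" "U = join n (S, T)"
        using join_surj by blast
      have "w \<in> T" using U ST(1,3) by (auto simp: join_def indep_cc)
      then show "U \<in> join n ` (Ind n \<times> Iw)" using ST by auto
    qed
  qed
qed (auto simp: card_join)

text \<open>Count all pairs of an independent set of the first \<open>n + 1\<close> copies and one
  of the new copy, then subtract the pairs using both ends of the new link. By \<open>w_last\<close>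
  the subtracted family is a product.\<close>

lemma ipoly_rec:
  "ipoly (cc (Suc (Suc n))) = ipoly G * ipoly (cc (Suc n)) - setpoly Iv * setpoly Iw * ipoly (cc n)"
proof -
  let ?m = "Suc n"
  let ?A = "Ind ?m" and ?B = "{T. independent_set G T}"
  let ?bad = "{S \<in> ?A. (?m, w) \<in> S} \<times> Iv"
  have bij: "bij_betw (join ?m) (?A \<times> ?B - ?bad) (Ind (Suc ?m))"
    unfolding bij_betw_def
  proof
    show "inj_on (join ?m) (?A \<times> ?B - ?bad)"
      by (rule inj_on_subset[OF inj_join]) auto
    show "join ?m ` (?A \<times> ?B - ?bad) = Ind (Suc ?m)"
    proof (intro equalityI subsetI)
      fix U assume "U \<in> join ?m ` (?A \<times> ?B - ?bad)"
      then obtain S T where ST: "S \<in> ?A" "independent_set G T" "U = join ?m (S, T)" "\<not> ((?m, w) \<in> S \<and> v \<in> T)"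
        by auto
      show "U \<in> Ind (Suc ?m)"
        using join_indep[OF ST(1,2)] ST(3,4) by simp
    next
      fix U assume "U \<in> Ind (Suc ?m)"
      then obtain S T where ST: "S \<in> ?A" "independent_set G T" "U = join ?m (S, T)" "(?m, w) \<in> S \<longrightarrow> v \<notin> T"
        by (rule join_surj)
      then show "U \<in> join ?m ` (?A \<times> ?B - ?bad)" by auto
    qed
  qed
  let ?f = "\<lambda>ST. monom (1::real) (card (fst ST) + card (snd ST))"
  have fA: "finite ?A" and fB: "finite ?B"
    by (rule finite_indep[OF fin_cc], rule finite_indep[OF fin])
  have prod: "sum ?f (X \<times> Y) = setpoly X * setpoly Y" for X :: "(nat \<times> 'a) set set" and Y :: "'a set set"
    by (simp add: setpoly_def sum_product sum.cartesian_product mult_monom split_beta)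
  have "ipoly (cc (Suc ?m)) = (\<Sum>ST\<in>?A \<times> ?B - ?bad. monom 1 (card (join ?m ST)))"
    unfolding setpoly_def using sum.reindex_bij_betw[OF bij, of "\<lambda>S. monom (1::real) (card S)"] by simp
  also have "\<dots> = sum ?f (?A \<times> ?B - ?bad)"
    by (intro sum.cong) (auto simp: card_join)
  also have "\<dots> = sum ?f (?A \<times> ?B) - sum ?f ?bad"
    using fA fB by (intro sum_diff) auto
  finally show ?thesis
    by (simp only: prod w_last mult_ac)
qed

lemma ipoly_1: "ipoly (cc (Suc 0)) = ipoly G"
proof -
  have "bij_betw (join 0) (Ind 0 \<times> {T. independent_set G T}) (Ind (Suc 0))"
    unfolding bij_betw_def
  proof
    show "join 0 ` (Ind 0 \<times> {T. independent_set G T}) = Ind (Suc 0)"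
    proof (intro equalityI subsetI)
      fix U assume "U \<in> join 0 ` (Ind 0 \<times> {T. independent_set G T})"
      then obtain S T where ST: "S \<in> Ind 0" "independent_set G T" "U = join 0 (S, T)" by auto
      then show "U \<in> Ind (Suc 0)"
        using join_indep[OF ST(1,2)] by (auto simp: indep_cc)
    next
      fix U assume "U \<in> Ind (Suc 0)"
      then show "U \<in> join 0 ` (Ind 0 \<times> {T. independent_set G T})"
        using join_surj by blast
    qed
  qed (rule inj_join)
  then have "ipoly (cc (Suc 0)) = ipoly (cc 0) * ipoly G"
    by (rule setpoly_product) (auto simp: card_join)
  then show ?thesis by (simp add: ipoly_0)
qed

end

section \<open>Factorization of the recurrence\<close>

text \<open>The Chebyshev polynomials of the second kind, rescaled to be monic:
  \<open>cheb n\<close> at \<open>x\<close> is U_n(x/2).\<close>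

fun cheb :: "nat \<Rightarrow> real poly" where
  "cheb 0 = 1"
| "cheb (Suc 0) = [:0, 1:]"
| "cheb (Suc (Suc n)) = [:0, 1:] * cheb (Suc n) - cheb n"

lemma cheb_degree: "degree (cheb n) = n \<and> coeff (cheb n) n = 1"
proof (induction n rule: cheb.induct)
  case (3 n)
  have d: "degree ([:0, 1:] * cheb (Suc n)) = Suc (Suc n)"
    using 3 by (subst degree_mult_eq) auto
  have "degree (cheb (Suc (Suc n))) = Suc (Suc n)"
    using 3 d by (simp only: cheb.simps) (subst diff_conv_add_uminus, subst degree_add_eq_left, auto)
  moreover have "coeff (cheb n) (Suc (Suc n)) = 0"
    using 3 by (intro coeff_eq_0) simp
  ultimately show ?case using 3 by simp
qed auto

lemma cheb_cos: "poly (cheb n) (2 * cos t) * sin t = sin (real (n + 1) * t)"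
proof (induction n rule: cheb.induct)
  case (2)
  show ?case using sin_double[of t] by (simp add: mult_ac)
next
  case (3 n)
  have s: "sin (real (n + 3) * t) + sin (real (n + 1) * t) = 2 * cos t * sin (real (n + 2) * t)"
  proof -
    have "(real (n + 3) * t + real (n + 1) * t) / 2 = real (n + 2) * t"
      "(real (n + 3) * t - real (n + 1) * t) / 2 = t"
      by (simp_all add: field_simps)
    then show ?thesis
      using sin_plus_sin[of "real (n + 3) * t" "real (n + 1) * t"] by (simp only: mult_ac)
  qed
  have "poly (cheb (Suc (Suc n))) (2 * cos t) * sin t
      = 2 * cos t * (poly (cheb (Suc n)) (2 * cos t) * sin t) - poly (cheb n) (2 * cos t) * sin t"
    by (simp add: algebra_simps)
  then show ?case using 3 s by (simp add: numeral_eq_Suc algebra_simps)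
qed simp

definition ang :: "nat \<Rightarrow> nat \<Rightarrow> real" where
  "ang n j = real j * pi / real (n + 1)"

lemma ang_bounds: "1 \<le> j \<Longrightarrow> j \<le> n \<Longrightarrow> 0 < ang n j \<and> ang n j < pi"
  using mult_strict_right_mono[of "real j / real (n + 1)" 1 pi]
  by (simp add: ang_def)

lemma ang_leI:
  assumes "real b * real j \<le> real a * real (n + 1)" "0 < b"
  shows "ang n j \<le> real a / real b * pi"
proof -
  have "real j / real (n + 1) \<le> real a / real b"
    using assms by (simp add: field_simps)
  then show ?thesis
    using mult_right_mono[of _ _ pi] by (fastforce simp: ang_def)
qed

lemma ang_geI:
  assumes "real a * real (n + 1) \<le> real b * real j" "0 < b"
  shows "real a / real b * pi \<le> ang n j"
proof -
  have "real a / real b \<le> real j / real (n + 1)"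
    using assms by (simp add: field_simps)
  then show ?thesis
    using mult_right_mono[of _ _ pi] by (fastforce simp: ang_def)
qed

text \<open>Both sides are monic of degree \<open>n\<close>, so their difference has degree below
  \<open>n\<close>. It vanishes at the \<open>n\<close> numbers \<open>2 * cos (ang n j)\<close>,
  which are distinct since cosine is injective on the interval from 0 to \<open>pi\<close>.\<close>

lemma cheb_prod: "cheb n = (\<Prod>j\<in>{1..n}. [:- (2 * cos (ang n j)), 1:])"
proof (rule ccontr)
  let ?P = "\<Prod>j\<in>{1..n}. [:- (2 * cos (ang n j)), 1:]"
  assume ne: "cheb n \<noteq> ?P"
  define D where "D = cheb n - ?P"
  have D0: "D \<noteq> 0" using ne by (simp add: D_def)
  have dP: "degree ?P = n"
    by (subst degree_prod_eq_sum_degree) auto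
  have lP: "lead_coeff ?P = 1"
    by (simp add: lead_coeff_prod)
  have "degree D \<le> n"
    unfolding D_def using dP cheb_degree[of n] by (intro degree_diff_le) auto
  moreover have "coeff D n = 0"
    using lP dP cheb_degree[of n] by (simp add: D_def)
  ultimately have dD: "degree D < n"
    using D0 by (metis le_neq_implies_less leading_coeff_0_iff)
  have inj: "inj_on (\<lambda>j. 2 * cos (ang n j)) {1..n}"
  proof (rule inj_onI)
    fix i j assume ij: "i \<in> {1..n}" "j \<in> {1..n}" "2 * cos (ang n i) = 2 * cos (ang n j)"
    then have "ang n i = ang n j"
      using ang_bounds[of i n] ang_bounds[of j n] cos_inj_pi[of "ang n i" "ang n j"] by auto
    then show "i = j" by (simp add: ang_def)
  qed
  have "poly D (2 * cos (ang n j)) = 0" if j: "j \<in> {1..n}" for j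
  proof -
    have "sin (real (n + 1) * ang n j) = 0"
      by (simp add: ang_def)
    moreover have "sin (ang n j) \<noteq> 0"
      using ang_bounds[of j n] j sin_gt_zero[of "ang n j"] by auto
    ultimately have "poly (cheb n) (2 * cos (ang n j)) = 0"
      using cheb_cos[of n "ang n j"] by simp
    moreover have "poly ?P (2 * cos (ang n j)) = 0"
      using j by (auto simp: poly_prod)
    ultimately show ?thesis by (simp add: D_def)
  qed
  then have "(\<lambda>j. 2 * cos (ang n j)) ` {1..n} \<subseteq> {x. poly D x = 0}" by auto
  then have "card ((\<lambda>j. 2 * cos (ang n j)) ` {1..n}) \<le> degree D"
    using card_mono[OF poly_roots_finite[OF D0]] card_poly_roots_bound[OF D0] order_trans by blast
  then show False
    using dD card_image[OF inj] by simp
qed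

text \<open>Serves twice: to merge the zeros of \<open>cheb n\<close> that differ by a sign, and to
  pair quadratic factors with large and small \<open>c\<close>.\<close>

lemma prod_fold:
  fixes F :: "nat \<Rightarrow> 'b :: comm_monoid_mult"
  shows "(\<Prod>j\<in>{1..n}. F j) = (\<Prod>j\<in>{1..n div 2}. F j * F (n + 1 - j)) * (if odd n then F (n div 2 + 1) else 1)"
proof -
  let ?J = "n div 2"
  let ?M = "if odd n then {?J + 1} else {}"
  have r: "(\<lambda>j. n + 1 - j) ` {1..?J} = {n + 1 - ?J..n}"
  proof (intro equalityI subsetI)
    fix x assume "x \<in> {n + 1 - ?J..n}"
    then have "x = n + 1 - (n + 1 - x)" "n + 1 - x \<in> {1..?J}" by auto
    then show "x \<in> (\<lambda>j. n + 1 - j) ` {1..?J}" by blast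
  qed auto
  have inj: "inj_on (\<lambda>j. n + 1 - j) {1..?J}"
    by (auto simp: inj_on_def)
  have s: "{1..n} = {1..?J} \<union> (?M \<union> {n + 1 - ?J..n})"
  proof (cases "even n")
    case True
    then obtain m where "n = 2 * m" by (rule evenE)
    then show ?thesis by auto
  next
    case False
    then obtain m where "n = 2 * m + 1" by (rule oddE)
    then show ?thesis by auto
  qed
  have "?M \<inter> {n + 1 - ?J..n} = {}"
  proof (cases "even n")
    case False
    then obtain m where "n = 2 * m + 1" by (rule oddE)
    then show ?thesis by auto
  qed simp
  note M = this
  have "(\<Prod>j\<in>{1..n}. F j) = (\<Prod>j\<in>{1..?J}. F j) * (\<Prod>j\<in>?M \<union> {n + 1 - ?J..n}. F j)"
    by (subst s, subst prod.union_disjoint) auto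
  also have "(\<Prod>j\<in>?M \<union> {n + 1 - ?J..n}. F j) = (if odd n then F (?J + 1) else 1) * (\<Prod>j\<in>{n + 1 - ?J..n}. F j)"
    by (subst prod.union_disjoint) (use M in auto)
  also have "(\<Prod>j\<in>{n + 1 - ?J..n}. F j) = (\<Prod>j\<in>{1..?J}. F (n + 1 - j))"
    unfolding r[symmetric] by (subst prod.reindex[OF inj]) simp
  finally show ?thesis
    by (simp add: prod.distrib mult_ac)
qed

lemma cos_ang_reflect: "j \<le> n \<Longrightarrow> cos (ang n (Suc n - j)) = - cos (ang n j)"
proof -
  assume "j \<le> n"
  then have "ang n (Suc n - j) = pi - ang n j"
    by (simp add: ang_def of_nat_diff field_simps)
  then show ?thesis by simp
qed

text \<open>Merging opposite zeros leaves only \<open>y\<^sup>2\<close>, apart from one factor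
  \<open>y\<close> for odd \<open>n\<close>; this removes the square root in the next lemma.\<close>

lemma poly_cheb_fold:
  "poly (cheb n) y = (\<Prod>j\<in>{1..n div 2}. y\<^sup>2 - (2 * cos (ang n j))\<^sup>2) * (if odd n then y else 1)"
proof -
  have mid: "cos (ang n (n div 2 + 1)) = 0" if "odd n"
  proof -
    obtain m where "n = 2 * m + 1" using \<open>odd n\<close> by (rule oddE)
    then have "ang n (n div 2 + 1) = pi / 2" by (simp add: ang_def field_simps)
    then show ?thesis by (metis cos_pi_half)
  qed
  have "poly (cheb n) y = (\<Prod>j\<in>{1..n}. y - 2 * cos (ang n j))"
    by (subst cheb_prod) (simp add: poly_prod)
  also have "\<dots> = (\<Prod>j\<in>{1..n div 2}. (y - 2 * cos (ang n j)) * (y - 2 * cos (ang n (n + 1 - j))))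
      * (if odd n then y - 2 * cos (ang n (n div 2 + 1)) else 1)"
    by (rule prod_fold)
  also have "\<dots> = (\<Prod>j\<in>{1..n div 2}. y\<^sup>2 - (2 * cos (ang n j))\<^sup>2) * (if odd n then y else 1)"
    using mid by (intro arg_cong2[where f = "(*)"] prod.cong)
      (auto simp: cos_ang_reflect power2_eq_square algebra_simps)
  finally show ?thesis .
qed

text \<open>Where \<open>h\<close> is positive, dividing the recurrence by powers of the square root
  of \<open>h\<close> turns it into that of \<open>cheb\<close> at \<open>g\<close> over this root.
  The folded product is polynomial in \<open>g\<close> and \<open>h\<close>, and agreement at
  infinitely many points is equality.\<close>

lemma continuant_factorization:
  fixes p :: "nat \<Rightarrow> real poly"
  assumes "p 0 = 1" "p 1 = g" and rec: "\<And>n. p (Suc (Suc n)) = g * p (Suc n) - h * p n"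
    and h: "infinite {x. 0 < poly h x}"
  shows "p n = (\<Prod>j\<in>{1..n div 2}. g\<^sup>2 - smult ((2 * cos (ang n j))\<^sup>2) h) * (if odd n then g else 1)"
    (is "_ = ?R")
proof -
  have "poly (p n) x = poly ?R x" if "0 < poly h x" for x
  proof -
    define s where "s = sqrt (poly h x)"
    have s: "0 < s" "s\<^sup>2 = poly h x" using that by (auto simp: s_def)
    define y where "y = poly g x / s"
    have y: "poly g x = s * y" using s by (simp add: y_def)
    have "poly (p n) x = s ^ n * poly (cheb n) y" for n
    proof (induction n rule: cheb.induct)
      case (3 n)
      then show ?case
        using s by (simp add: rec y power2_eq_square algebra_simps flip: s(2))
    qed (use assms(1,2) y in auto)
    also have "s ^ n * poly (cheb n) y = poly ?R x"
    proof -
      \<comment> \<open>One factor \<open>s\<^sup>2\<close> for each pair of zeros, and one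
        \<open>s\<close> for the middle zero.\<close>
      have e: "s ^ n = (\<Prod>j\<in>{1..n div 2}. s\<^sup>2) * (if odd n then s else 1)"
      proof (cases "even n")
        case True
        then obtain m where "n = 2 * m" by (rule evenE)
        then show ?thesis by (simp flip: power_mult)
      next
        case False
        then obtain m where "n = 2 * m + 1" by (rule oddE)
        then show ?thesis by (simp flip: power_mult)
      qed
      have "poly ?R x = (\<Prod>j\<in>{1..n div 2}. s\<^sup>2 * (y\<^sup>2 - (2 * cos (ang n j))\<^sup>2)) * (if odd n then s * y else 1)"
        by (simp add: poly_prod y s(2)[symmetric] power_mult_distrib algebra_simps)
      also have "\<dots> = s ^ n * poly (cheb n) y"
        unfolding e poly_cheb_fold prod.distrib by simp
      finally show ?thesis by simp
    qed
    finally show ?thesis .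
  qed
  then have "{x. 0 < poly h x} \<subseteq> {x. poly (p n - ?R) x = 0}"
    by auto
  then have "infinite {x. poly (p n - ?R) x = 0}"
    using h infinite_super by blast
  then have "p n - ?R = 0"
    using poly_roots_finite by blast
  then show ?thesis by simp
qed

lemma cos_sq_le:
  assumes "t \<le> a" "a \<le> pi / 2" "0 \<le> t"
  shows "(2 * cos a)\<^sup>2 \<le> (2 * cos t)\<^sup>2"
  using assms by (intro power_mono mult_left_mono cos_monotone_0_pi_le) (auto intro: cos_ge_zero)

text \<open>A parameter above 3 needs an angle below \<open>pi / 6\<close>, that is
  \<open>6 * j < n + 1\<close>. The partner index \<open>n div 2 + 1 - j\<close> then has angle at
  least \<open>pi / 3\<close> and parameter at most 1, which is the situation of
  \<open>QQ\<close>.\<close>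

lemma logc_continuant:
  fixes p :: "nat \<Rightarrow> real poly"
  assumes "p 0 = 1" "p 1 = g" "\<And>n. p (Suc (Suc n)) = g * p (Suc n) - h * p n"
    and h: "\<And>x. 0 < x \<Longrightarrow> 0 < poly h x"
    and g: "logc g"
    and Q: "\<And>c. 0 \<le> c \<Longrightarrow> c \<le> 3 \<Longrightarrow> logc (g\<^sup>2 - smult c h)"
    and QQ: "\<And>c d. 3 \<le> c \<Longrightarrow> c \<le> 4 \<Longrightarrow> 0 \<le> d \<Longrightarrow> d \<le> 1 \<Longrightarrow>
      logc ((g\<^sup>2 - smult c h) * (g\<^sup>2 - smult d h))"
  shows "logc (p n)"
proof -
  define c where "c j = (2 * cos (ang n j))\<^sup>2" for j
  define F where "F j = g\<^sup>2 - smult (c j) h" for j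
  let ?J = "n div 2"
  have c: "0 \<le> c j" "c j \<le> 4" for j
    using abs_cos_le_one[of "ang n j"] by (auto simp: c_def power_mult_distrib abs_square_le_1)
  have half: "ang n j \<le> pi / 2" if "j \<le> ?J" for j
  proof -
    have "2 * j \<le> n + 1" using that by linarith
    then have "real (2 * j) \<le> real (1 * (n + 1))" by (simp only: of_nat_le_iff mult_1)
    then have "real 2 * real j \<le> real 1 * real (n + 1)" by (simp only: of_nat_mult)
    from ang_leI[OF this] show ?thesis by simp
  qed
  have low: "c j \<le> 3" if "n + 1 \<le> 6 * j" "j \<le> ?J" for j
  proof -
    have "real (1 * (n + 1)) \<le> real (6 * j)" using that by (simp only: of_nat_le_iff mult_1)
    then have "real 1 * real (n + 1) \<le> real 6 * real j" by (simp only: of_nat_mult)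
    from ang_geI[OF this] have "pi / 6 \<le> ang n j" by simp
    then have "c j \<le> (2 * cos (pi / 6))\<^sup>2"
      unfolding c_def using half[OF that(2)] by (intro cos_sq_le) auto
    then show ?thesis by (simp add: cos_30 power_mult_distrib power_divide)
  qed
  have vlow: "c j \<le> 1" if "n + 1 \<le> 3 * j" "j \<le> ?J" for j
  proof -
    have "real (1 * (n + 1)) \<le> real (3 * j)" using that by (simp only: of_nat_le_iff mult_1)
    then have "real 1 * real (n + 1) \<le> real 3 * real j" by (simp only: of_nat_mult)
    from ang_geI[OF this] have "pi / 3 \<le> ang n j" by simp
    then have "c j \<le> (2 * cos (pi / 3))\<^sup>2"
      unfolding c_def using half[OF that(2)] by (intro cos_sq_le) auto
    then show ?thesis by (simp add: cos_60)
  qed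
  have pair: "logc (F j * F (?J + 1 - j))" if j: "j \<in> {1..?J div 2}" for j
  proof (cases "n + 1 \<le> 6 * j")
    case True
    moreover have "n + 1 \<le> 6 * (?J + 1 - j)" "?J + 1 - j \<le> ?J" "j \<le> ?J" using j by auto
    ultimately show ?thesis
      unfolding F_def using low c by (intro logc_mult Q) auto
  next
    case False
    have l: "n + 1 \<le> 3 * (?J + 1 - j)" "?J + 1 - j \<le> ?J" "j \<le> ?J" using j False by auto
    show ?thesis
    proof (cases "c j \<le> 3")
      case True
      then show ?thesis
        unfolding F_def using vlow[OF l(1,2)] c by (intro logc_mult Q) auto
    next
      case False
      then show ?thesis
        unfolding F_def using vlow[OF l(1,2)] c by (intro QQ) auto
    qed
  qed
  \<comment> \<open>The unpaired middle index already has angle at least \<open>pi / 6\<close>, so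
    \<open>Q\<close> applies to it alone.\<close>
  have mid: "logc (F (?J div 2 + 1))" if "odd ?J"
  proof -
    obtain m where m: "?J = 2 * m + 1" using \<open>odd ?J\<close> by (rule oddE)
    then have "n + 1 \<le> 6 * (?J div 2 + 1)" "?J div 2 + 1 \<le> ?J" by auto
    then show ?thesis
      unfolding F_def using c by (intro Q low)
  qed
  have "logc (\<Prod>j\<in>{1..?J}. F j)"
  proof -
    have "logc (\<Prod>j\<in>{1..?J div 2}. F j * F (?J + 1 - j))"
      by (intro logc_prod pair)
    then show ?thesis
      unfolding prod_fold[of F ?J] using mid by (intro logc_mult) (auto intro: logc_one)
  qed
  moreover have "p n = (\<Prod>j\<in>{1..?J}. F j) * (if odd n then g else 1)"
    unfolding F_def c_def
  proof (rule continuant_factorization)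
    have "{0<..} \<subseteq> {x. 0 < poly h x}" using h by auto
    then show "infinite {x. 0 < poly h x}"
      using infinite_Ioi[of "0::real"] infinite_super by blast
  qed (use assms in auto)
  ultimately show ?thesis
    using g by (auto intro!: logc_mult logc_one)
qed

lemma (in concat_graph) indep_seq_cc:
  assumes "logc (ipoly (cc n))"
  shows "log_concave (indep_seq (cc n)) \<and> unimodal (indep_seq (cc n))"
  unfolding indep_seq_ipoly[OF fin_cc]
  by (rule seq_of_logc[OF assms]) (simp add: coeff_ipoly_0[OF fin_cc])

text \<open>The interface between graphs and algebra: from here on only \<open>g\<close> and
  \<open>h\<close> matter.\<close>

lemma (in concat_graph) logc_concatenation:
  assumes g: "ipoly G = g" and h: "setpoly Iv * setpoly Iw = h"
    and "\<And>x. 0 < x \<Longrightarrow> 0 < poly h x" "logc g"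
    and "\<And>c. 0 \<le> c \<Longrightarrow> c \<le> 3 \<Longrightarrow> logc (g\<^sup>2 - smult c h)"
    and "\<And>c d. 3 \<le> c \<Longrightarrow> c \<le> 4 \<Longrightarrow> 0 \<le> d \<Longrightarrow> d \<le> 1 \<Longrightarrow>
      logc ((g\<^sup>2 - smult c h) * (g\<^sup>2 - smult d h))"
  shows "log_concave (indep_seq (cc n)) \<and> unimodal (indep_seq (cc n))"
proof (rule indep_seq_cc)
  show "logc (ipoly (cc n))"
    by (rule logc_continuant[where p = "\<lambda>n. ipoly (cc n)" and g = g and h = h])
      (use assms(3-) in \<open>simp_all add: ipoly_0 ipoly_1 ipoly_rec g h\<close>)
qed

abbreviation X :: "real poly" where "X \<equiv> monom 1 1"
abbreviation X1 :: "real poly" where "X1 \<equiv> [:1, 1:]"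

section \<open>Double stars\<close>

lemma indep_double_star:
  "independent_set (double_star l1 l2) S \<longleftrightarrow>
     S \<subseteq> {Center_v, Center_w} \<union> Leaf_v ` {..<l1} \<union> Leaf_w ` {..<l2} \<and>
     \<not> (Center_v \<in> S \<and> Center_w \<in> S) \<and>
     (Center_v \<in> S \<longrightarrow> S \<inter> range Leaf_v = {}) \<and> (Center_w \<in> S \<longrightarrow> S \<inter> range Leaf_w = {})"
  (is "_ \<longleftrightarrow> ?sub \<and> ?r")
proof
  assume S: "independent_set (double_star l1 l2) S"
  then have sub: ?sub by (simp add: independent_set_def double_star_def Let_def)
  have no: "(x, y) \<notin> parcs (double_star l1 l2)" if "x \<in> S" "y \<in> S" for x y
    using S that by (simp add: independent_set_def)
  have "\<not> (Center_v \<in> S \<and> Center_w \<in> S)"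
    using no[of Center_v Center_w] by (auto simp: double_star_def Let_def)
  moreover have False if "Center_v \<in> S" "Leaf_v i \<in> S" for i
  proof -
    have "i < l1" using sub that by auto
    then show False using no[OF that] by (auto simp: double_star_def Let_def)
  qed
  moreover have False if "Center_w \<in> S" "Leaf_w i \<in> S" for i
  proof -
    have "i < l2" using sub that by auto
    then show False using no[OF that] by (auto simp: double_star_def Let_def)
  qed
  ultimately show "?sub \<and> ?r" using sub by auto
next
  assume "?sub \<and> ?r"
  then show "independent_set (double_star l1 l2) S"
    unfolding independent_set_def by (auto simp: double_star_def Let_def)
qed

lemma setpoly_Leaf:
  "setpoly (Pow (Leaf_v ` {..<l1})) = X1 ^ l1" "setpoly (Pow (Leaf_w ` {..<l2})) = X1 ^ l2"
  "setpoly (Pow (Leaf_v ` {..<l1} \<union> Leaf_w ` {..<l2})) = X1 ^ (l1 + l2)"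
proof -
  have "card (Leaf_v ` {..<l1} \<union> Leaf_w ` {..<l2}) = l1 + l2"
    by (subst card_Un_disjoint) (auto simp: card_image inj_on_def)
  then show "setpoly (Pow (Leaf_v ` {..<l1} \<union> Leaf_w ` {..<l2})) = X1 ^ (l1 + l2)"
    by (simp add: setpoly_Pow)
qed (simp_all add: setpoly_Pow card_image inj_on_def)

lemma setpoly_Center_v:
  "setpoly {S. independent_set (double_star l1 l2) S \<and> Center_v \<in> S} = X * X1 ^ l2"
proof -
  have "{S. independent_set (double_star l1 l2) S \<and> Center_v \<in> S} = insert Center_v ` Pow (Leaf_w ` {..<l2})"
  proof (intro equalityI subsetI)
    fix S assume "S \<in> {S. independent_set (double_star l1 l2) S \<and> Center_v \<in> S}"
    then have S: "Center_v \<in> S" "S \<subseteq> {Center_v, Center_w} \<union> Leaf_v ` {..<l1} \<union> Leaf_w ` {..<l2}"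
      "Center_w \<notin> S" "S \<inter> range Leaf_v = {}"
      by (auto simp: indep_double_star)
    then have "S = insert Center_v (S - {Center_v})" "S - {Center_v} \<in> Pow (Leaf_w ` {..<l2})"
      by blast+
    then show "S \<in> insert Center_v ` Pow (Leaf_w ` {..<l2})" by blast
  qed (auto simp: indep_double_star)
  then show ?thesis
    unfolding setpoly_Leaf(2)[symmetric]
    by (simp only:) (rule setpoly_insert_image, auto dest: finite_subset)
qed

lemma setpoly_Center_w:
  "setpoly {S. independent_set (double_star l1 l2) S \<and> Center_w \<in> S} = X * X1 ^ l1"
proof -
  have "{S. independent_set (double_star l1 l2) S \<and> Center_w \<in> S} = insert Center_w ` Pow (Leaf_v ` {..<l1})"
  proof (intro equalityI subsetI)
    fix S assume "S \<in> {S. independent_set (double_star l1 l2) S \<and> Center_w \<in> S}"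
    then have S: "Center_w \<in> S" "S \<subseteq> {Center_v, Center_w} \<union> Leaf_v ` {..<l1} \<union> Leaf_w ` {..<l2}"
      "Center_v \<notin> S" "S \<inter> range Leaf_w = {}"
      by (auto simp: indep_double_star)
    then have "S = insert Center_w (S - {Center_w})" "S - {Center_w} \<in> Pow (Leaf_v ` {..<l1})"
      by blast+
    then show "S \<in> insert Center_w ` Pow (Leaf_v ` {..<l1})" by blast
  qed (auto simp: indep_double_star)
  then show ?thesis
    unfolding setpoly_Leaf(1)[symmetric]
    by (simp only:) (rule setpoly_insert_image, auto dest: finite_subset)
qed

text \<open>An independent set contains neither center, only \<open>v\<close>, or only
  \<open>w\<close>; the permitted leaves are then chosen freely.\<close>

lemma ipoly_double_star:
  "ipoly (double_star l1 l2) = X1 ^ (l1 + l2) + X * (X1 ^ l1 + X1 ^ l2)"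
proof -
  let ?I = "{S. independent_set (double_star l1 l2) S}"
  let ?V = "{S. independent_set (double_star l1 l2) S \<and> Center_v \<in> S}"
  let ?W = "{S. independent_set (double_star l1 l2) S \<and> Center_w \<in> S}"
  let ?L = "Pow (Leaf_v ` {..<l1} \<union> Leaf_w ` {..<l2})"
  have "finite ?I"
    by (rule finite_indep) (simp add: double_star_def Let_def)
  then have fin: "finite ?V" "finite ?W" "finite ?L"
    by (simp_all add: Collect_conj_eq)
  have "?I = ?L \<union> (?V \<union> ?W)"
    by (auto simp: indep_double_star)
  moreover have "?L \<inter> (?V \<union> ?W) = {}" "?V \<inter> ?W = {}"
    by (auto simp: indep_double_star)
  ultimately have "setpoly ?I = setpoly ?L + (setpoly ?V + setpoly ?W)"
    using fin by (metis setpoly_Un finite_UnI)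
  then show ?thesis
    by (simp add: setpoly_Leaf setpoly_Center_v setpoly_Center_w algebra_simps)
qed

section \<open>Paths\<close>

lemma indep_path:
  "independent_set (path_graph k) S \<longleftrightarrow> S \<subseteq> {1..k} \<and> (\<forall>i. i \<in> S \<longrightarrow> Suc i \<notin> S)"
proof
  assume S: "independent_set (path_graph k) S"
  then have sub: "S \<subseteq> {1..k}" by (simp add: independent_set_def path_graph_def Let_def)
  have "Suc i \<notin> S" if "i \<in> S" for i
  proof
    assume "Suc i \<in> S"
    then have "(i, Suc i) \<notin> parcs (path_graph k)" "1 \<le> i" "i < k"
      using S that sub by (auto simp: independent_set_def)
    then show False by (simp add: path_graph_def Let_def)
  qed
  with sub show "S \<subseteq> {1..k} \<and> (\<forall>i. i \<in> S \<longrightarrow> Suc i \<notin> S)" by blast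
next
  assume "S \<subseteq> {1..k} \<and> (\<forall>i. i \<in> S \<longrightarrow> Suc i \<notin> S)"
  then show "independent_set (path_graph k) S"
    by (auto simp: independent_set_def path_graph_def Let_def)
qed

text \<open>At most one vertex lies beyond \<open>j\<close>, and it is a neighbour of
  \<open>j\<close>; hence a set through \<open>j\<close> is free exactly on the first
  \<open>j - 2\<close> vertices. The two cases of \<open>k\<close> cover an end vertex and its
  neighbour.\<close>

lemma indep_path_insert:
  assumes "1 \<le> j" "j \<le> k" "k \<le> Suc j"
  shows "{S. independent_set (path_graph k) S \<and> j \<in> S} = insert j ` {S. independent_set (path_graph (j - 2)) S}"
proof (intro equalityI subsetI)
  fix S assume S: "S \<in> {S. independent_set (path_graph k) S \<and> j \<in> S}"
  have "i \<in> {1..j - 2}" if "i \<in> S" "i \<noteq> j" for i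
  proof -
    have "1 \<le> i" "i \<le> k" "Suc i \<noteq> j" "i \<noteq> Suc j"
      using S that by (auto simp: indep_path)
    then show ?thesis using that assms by auto
  qed
  then have "S - {j} \<subseteq> {1..j - 2}" by blast
  then have "independent_set (path_graph (j - 2)) (S - {j})"
    using S by (simp add: indep_path)
  then show "S \<in> insert j ` {S. independent_set (path_graph (j - 2)) S}"
    using S by (intro image_eqI[of _ _ "S - {j}"]) auto
next
  fix S assume "S \<in> insert j ` {S. independent_set (path_graph (j - 2)) S}"
  then obtain T where T: "S = insert j T" "T \<subseteq> {1..j - 2}" "\<And>i. i \<in> T \<Longrightarrow> Suc i \<notin> T"
    by (auto simp: indep_path)
  have "Suc i \<noteq> j" "i \<noteq> Suc j" "i \<le> k" "1 \<le> i" if "i \<in> T" for i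
  proof -
    have "i \<in> {1..j - 2}" using T(2) that by blast
    then show "Suc i \<noteq> j" "i \<noteq> Suc j" "i \<le> k" "1 \<le> i" using assms by auto
  qed
  then show "S \<in> {S. independent_set (path_graph k) S \<and> j \<in> S}"
    using T(1,3) assms by (auto simp: indep_path)
qed

fun pathpoly :: "nat \<Rightarrow> real poly" where
  "pathpoly 0 = 1"
| "pathpoly (Suc 0) = X1"
| "pathpoly (Suc (Suc n)) = pathpoly (Suc n) + X * pathpoly n"

lemma finite_indep_path: "finite {S. independent_set (path_graph k) S}"
  by (rule finite_indep) (simp add: path_graph_def Let_def)

lemma setpoly_path_insert:
  assumes "1 \<le> j" "j \<le> k" "k \<le> Suc j"
  shows "setpoly {S. independent_set (path_graph k) S \<and> j \<in> S} = X * ipoly (path_graph (j - 2))"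
  unfolding indep_path_insert[OF assms]
  using assms by (intro setpoly_insert_image) (auto simp: indep_path dest: finite_subset)

text \<open>Truncated subtraction makes this correct for \<open>k = 0\<close> too, where the second
  summand is just \<open>X\<close>.\<close>

lemma ipoly_path_Suc:
  "ipoly (path_graph (Suc k)) = ipoly (path_graph k) + X * ipoly (path_graph (Suc k - 2))"
proof -
  have "{S. independent_set (path_graph (Suc k)) S} =
      {S. independent_set (path_graph k) S} \<union> {S. independent_set (path_graph (Suc k)) S \<and> Suc k \<in> S}"
    by (auto simp: indep_path le_Suc_eq subset_iff)
  moreover have "setpoly (\<dots>) =
      ipoly (path_graph k) + setpoly {S. independent_set (path_graph (Suc k)) S \<and> Suc k \<in> S}"
  proof (rule setpoly_Un)
    show "finite {S. independent_set (path_graph (Suc k)) S \<and> Suc k \<in> S}"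
      using finite_indep_path[of "Suc k"] by (simp add: Collect_conj_eq)
  qed (use finite_indep_path in \<open>auto simp: indep_path\<close>)
  ultimately have "ipoly (path_graph (Suc k)) =
      ipoly (path_graph k) + setpoly {S. independent_set (path_graph (Suc k)) S \<and> Suc k \<in> S}"
    by simp
  then show ?thesis
    using setpoly_path_insert[of "Suc k" "Suc k"] by simp
qed

lemma ipoly_path: "ipoly (path_graph k) = pathpoly k"
proof (induction k rule: pathpoly.induct)
  have 0: "{S. independent_set (path_graph 0) S} = {{}}" by (auto simp: indep_path)
  {
    case 1
    show ?case by (simp add: 0 setpoly_def)
  next
    case 2
    show ?case by (simp only: ipoly_path_Suc) (simp add: 0 setpoly_def monom_altdef)
  next
    case (3 n)
    then show ?case by (simp add: ipoly_path_Suc[of "Suc n"])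
  }
qed

text \<open>A leaf of the path may be vertex 1 instead of \<open>k\<close>; the reflection reduces
  that case to the other end.\<close>

lemma setpoly_path_reflect:
  assumes "1 \<le> j" "j \<le> k"
  shows "setpoly {S. independent_set (path_graph k) S \<and> j \<in> S}
    = setpoly {S. independent_set (path_graph k) S \<and> Suc k - j \<in> S}"
proof (rule setpoly_bij)
  let ?f = "\<lambda>i. Suc k - i"
  have ff: "?f ` ?f ` S = S" if "S \<subseteq> {1..k}" for S
  proof -
    have "?f ` ?f ` S = id ` S"
      unfolding image_image using that by (intro image_cong) auto
    then show ?thesis by simp
  qed
  have ind: "independent_set (path_graph k) (?f ` S)" if "independent_set (path_graph k) S" for S
  proof -
    have S: "S \<subseteq> {1..k}" "\<And>i. i \<in> S \<Longrightarrow> Suc i \<notin> S" using that by (auto simp: indep_path)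
    have "Suc (?f i) \<noteq> ?f i'" if "i \<in> S" "i' \<in> S" for i i'
    proof
      assume "Suc (?f i) = ?f i'"
      moreover have "i \<le> k" "i' \<le> k" using S(1) that by auto
      ultimately have "i = Suc i'" by simp
      then show False using S(2) that by blast
    qed
    moreover have "?f i \<in> {1..k}" if "i \<in> S" for i
    proof -
      have "i \<in> {1..k}" using S(1) that by blast
      then show ?thesis by auto
    qed
    then have "?f ` S \<subseteq> {1..k}" by blast
    ultimately show ?thesis unfolding indep_path by blast
  qed
  let ?A = "{S. independent_set (path_graph k) S \<and> Suc k - j \<in> S}"
  let ?B = "{S. independent_set (path_graph k) S \<and> j \<in> S}"
  have 1: "?f ` S \<in> ?B" if "S \<in> ?A" for S
    using that ind[of S] assms by (auto intro!: image_eqI[of j ?f "Suc k - j"])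
  have 2: "?f ` S \<in> ?A" if "S \<in> ?B" for S
    using that ind[of S] by auto
  show "bij_betw ((`) ?f) ?A ?B"
  proof (rule bij_betw_byWitness[where f' = "(`) ?f"])
    show "\<forall>S\<in>?A. ?f ` ?f ` S = S" "\<forall>S\<in>?B. ?f ` ?f ` S = S"
      using ff by (auto simp: indep_path simp del: image_image)
  qed (use 1 2 in auto)
  show "card (?f ` S) = card S" if "S \<in> ?A" for S
  proof (intro card_image)
    have "inj_on ?f {1..k}" by (auto simp: inj_on_def)
    moreover have "S \<subseteq> {1..k}" using that by (simp add: indep_path)
    ultimately show "inj_on ?f S" by (rule inj_on_subset)
  qed
qed

lemma path_leafD:
  assumes "is_leaf (path_graph k) w" "(v, w) \<in> parcs (path_graph k)" "2 \<le> k"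
  shows "(w = k \<and> v = k - 1) \<or> (w = 1 \<and> v = 2)"
proof -
  have w: "1 \<le> w" "w \<le> k" using assms(1) by (auto simp: is_leaf_def path_graph_def Let_def)
  have vw: "v = Suc w \<or> w = Suc v"
    using assms(2) by (auto simp: path_graph_def Let_def)
  have "w = 1 \<or> w = k"
  proof (rule ccontr)
    assume "\<not> (w = 1 \<or> w = k)"
    then have "out_arcs (with_proj (path_graph k)) w = {(w, w - 1), (w, Suc w)}"
      using w by (auto simp: out_arcs_def path_graph_def Let_def)
    then have "out_degree (with_proj (path_graph k)) w = 2"
      using w by (simp add: out_degree_def card_insert_if)
    then show False using assms(1) by (simp add: is_leaf_def)
  qed
  moreover have "v \<le> k" "1 \<le> v"
    using assms(2) by (auto simp: path_graph_def Let_def)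
  ultimately show ?thesis using vw assms(3) by auto
qed

text \<open>For \<open>k = 2\<close> the index \<open>k - 3\<close> truncates to 0, as it should:
  only the singleton of \<open>v\<close> contains \<open>v\<close>.\<close>

lemma setpoly_path_leaf:
  assumes "is_leaf (path_graph k) w" "(v, w) \<in> parcs (path_graph k)" "2 \<le> k"
  shows "setpoly {S. independent_set (path_graph k) S \<and> v \<in> S} = X * pathpoly (k - 3)"
    "setpoly {S. independent_set (path_graph k) S \<and> w \<in> S} = X * pathpoly (k - 2)"
proof -
  have k: "setpoly {S. independent_set (path_graph k) S \<and> k - 1 \<in> S} = X * pathpoly (k - 3)"
    "setpoly {S. independent_set (path_graph k) S \<and> k \<in> S} = X * pathpoly (k - 2)"
    using setpoly_path_insert[of "k - 1" k] setpoly_path_insert[of k k] assms(3)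
    by (auto simp: ipoly_path numeral_eq_Suc)
  have "Suc k - 2 = k - 1" "Suc k - 1 = k" using assms(3) by auto
  then show "setpoly {S. independent_set (path_graph k) S \<and> v \<in> S} = X * pathpoly (k - 3)"
    "setpoly {S. independent_set (path_graph k) S \<and> w \<in> S} = X * pathpoly (k - 2)"
    using path_leafD[OF assms] k setpoly_path_reflect[of 2 k] setpoly_path_reflect[of 1 k] assms(3)
    by auto
qed

section \<open>Log-concavity tests on coefficient lists\<close>

text \<open>The hypotheses of \<open>logcI\<close> as a check on lists; accordingly the last entry
  need only be nonnegative.\<close>

fun lc_list :: "real list \<Rightarrow> bool" where
  "lc_list (a # b # c # r) \<longleftrightarrow> 0 < a \<and> a * c \<le> b * b \<and> lc_list (b # c # r)"
| "lc_list [a, b] \<longleftrightarrow> 0 < a \<and> 0 \<le> b"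
| "lc_list [a] \<longleftrightarrow> 0 \<le> a"
| "lc_list [] \<longleftrightarrow> False"

lemma lc_list_nth:
  "lc_list xs \<Longrightarrow> xs \<noteq> [] \<and> (\<forall>i. Suc i < length xs \<longrightarrow> 0 < xs ! i) \<and> 0 \<le> last xs \<and>
    (\<forall>i. i + 2 < length xs \<longrightarrow> xs ! i * xs ! (i + 2) \<le> xs ! (i + 1) * xs ! (i + 1))"
  by (induction xs rule: lc_list.induct) (auto simp: nth_Cons split: nat.splits)

lemma logc_Poly:
  assumes "lc_list xs"
  shows "logc (Poly xs)"
proof -
  note n = lc_list_nth[OF assms]
  have c: "coeff (Poly xs) i = (if i < length xs then xs ! i else 0)" for i
    by (simp add: nth_default_def)
  show ?thesis
  proof (rule logcI[where n = "length xs - 1"])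
    show "0 < coeff (Poly xs) i" if "i < length xs - 1" for i
      using n that by (simp add: c less_diff_conv del: coeff_Poly_eq)
    show "0 \<le> coeff (Poly xs) (length xs - 1)"
      using n last_conv_nth[of xs] by (simp add: c del: coeff_Poly_eq)
    show "coeff (Poly xs) i = 0" if "length xs - 1 < i" for i
      using that by (simp add: c del: coeff_Poly_eq)
    show "coeff (Poly xs) i * coeff (Poly xs) (i + 2) \<le> (coeff (Poly xs) (i + 1))\<^sup>2" if "i + 2 \<le> length xs - 1" for i
    proof -
      have "i + 2 < length xs" using that by linarith
      then show ?thesis using n by (simp add: c power2_eq_square del: coeff_Poly_eq)
    qed
  qed
qed

text \<open>A pair \<open>(p, h)\<close> stands for the function \<open>p - c * h\<close> of the parameter \<open>c \<in> {0..4}\<close>;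
  \<open>bern_le\<close> compares two products of such functions through the Bernstein coefficients of the
  difference, which is quadratic in \<open>c\<close>.\<close>

abbreviation val :: "real \<Rightarrow> int \<times> int \<Rightarrow> real" where
  "val c z \<equiv> real_of_int (fst z) - c * real_of_int (snd z)"

fun bern_le :: "int \<times> int \<Rightarrow> int \<times> int \<Rightarrow> int \<times> int \<Rightarrow> int \<times> int \<Rightarrow> bool" where
  "bern_le (p, h) (p', h') (q, k) (q', k') \<longleftrightarrow>
    (let a = q * q' - p * p'; b = p * h' + p' * h - q * k' - q' * k; d = k * k' - h * h'
     in 0 \<le> a \<and> 0 \<le> a + 2 * b \<and> 0 \<le> a + 4 * b + 16 * d)"

fun pos :: "int \<times> int \<Rightarrow> bool" where "pos (p, h) \<longleftrightarrow> 0 < p \<and> 4 * h < p"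
fun nneg :: "int \<times> int \<Rightarrow> bool" where "nneg (p, h) \<longleftrightarrow> 0 \<le> p \<and> 4 * h \<le> p"

lemma bern_le:
  assumes "bern_le x y u v" "0 \<le> c" "c \<le> 4"
  shows "val c x * val c y \<le> val c u * val c v"
proof -
  obtain p h p' h' q k q' k' where xy: "x = (p, h)" "y = (p', h')" "u = (q, k)" "v = (q', k')"
    by (metis surj_pair)
  define a b d where "a = q * q' - p * p'" and "b = p * h' + p' * h - q * k' - q' * k" and "d = k * k' - h * h'"
  have nn: "0 \<le> a" "0 \<le> a + 2 * b" "0 \<le> a + 4 * b + 16 * d"
    using assms(1) by (auto simp: xy a_def b_def d_def Let_def)
  have "val c u * val c v - val c x * val c y = real_of_int a + real_of_int b * c + real_of_int d * c\<^sup>2"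
    by (simp add: xy a_def b_def d_def algebra_simps power2_eq_square)
  \<comment> \<open>Expansion in the Bernstein basis of degree 2 in \<open>c / 4\<close>, whose
    members are nonnegative for \<open>c\<close> from 0 to 4.\<close>
  also have "\<dots> = (1 - c / 4)\<^sup>2 * real_of_int a + 2 * (c / 4) * (1 - c / 4) * real_of_int (a + 2 * b)
      + (c / 4)\<^sup>2 * real_of_int (a + 4 * b + 16 * d)"
    by (simp add: field_simps power2_eq_square)
  also have "\<dots> \<ge> 0"
    using nn assms(2,3) by (intro add_nonneg_nonneg mult_nonneg_nonneg) (auto simp del: of_int_add of_int_mult)
  finally show ?thesis by simp
qed

text \<open>The function is affine in \<open>c\<close>, so its signs at 0 and 4 suffice.\<close>

lemma pos:
  assumes "pos x" "0 \<le> c" "c \<le> 4"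
  shows "0 < val c x"
proof -
  obtain p h where x: "x = (p, h)" by (metis surj_pair)
  have p: "0 < real_of_int p" "0 < real_of_int p - 4 * real_of_int h"
    using assms(1) by (auto simp: x)
  show ?thesis
  proof (cases "h \<le> 0")
    case True
    then have "c * real_of_int h \<le> 0" using assms(2) by (simp add: mult_nonneg_nonpos)
    then show ?thesis using p by (simp add: x)
  next
    case False
    then have "c * real_of_int h \<le> 4 * real_of_int h" using assms(3) by (intro mult_right_mono) auto
    then show ?thesis using p by (simp add: x)
  qed
qed

lemma nneg:
  assumes "nneg x" "0 \<le> c" "c \<le> 4"
  shows "0 \<le> val c x"
proof -
  obtain p h where x: "x = (p, h)" by (metis surj_pair)
  have p: "0 \<le> real_of_int p" "0 \<le> real_of_int p - 4 * real_of_int h"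
    using assms(1) by (auto simp: x)
  show ?thesis
  proof (cases "h \<le> 0")
    case True
    then have "c * real_of_int h \<le> 0" using assms(2) by (simp add: mult_nonneg_nonpos)
    then show ?thesis using p by (simp add: x)
  next
    case False
    then have "c * real_of_int h \<le> 4 * real_of_int h" using assms(3) by (intro mult_right_mono) auto
    then show ?thesis using p by (simp add: x)
  qed
qed

fun lc_pairs :: "(int \<times> int) list \<Rightarrow> bool" where
  "lc_pairs (a # b # d # r) \<longleftrightarrow> pos a \<and> bern_le a d b b \<and> lc_pairs (b # d # r)"
| "lc_pairs [a, b] \<longleftrightarrow> pos a \<and> nneg b"
| "lc_pairs [a] \<longleftrightarrow> nneg a"
| "lc_pairs [] \<longleftrightarrow> False"

lemma lc_pairs:
  assumes "0 \<le> c" "c \<le> 4"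
  shows "lc_pairs zs \<Longrightarrow> lc_list (map (val c) zs)"
  using assms
  by (induction zs rule: lc_pairs.induct) (auto simp del: pos.simps nneg.simps bern_le.simps
      dest: pos[where c = c] nneg[where c = c] bern_le[where c = c])

text \<open>The second list is padded with zeros; its excess entries would be lost, hence the length
  hypotheses below.\<close>

fun pairs :: "int list \<Rightarrow> int list \<Rightarrow> (int \<times> int) list" where
  "pairs (p # ps) (h # hs) = (p, h) # pairs ps hs"
| "pairs (p # ps) [] = (p, 0) # pairs ps []"
| "pairs [] hs = []"

definition ipol :: "int list \<Rightarrow> real poly" where
  "ipol xs = Poly (map real_of_int xs)"

lemma ipol_simps [simp]: "ipol [] = 0" "ipol (x # xs) = pCons (real_of_int x) (ipol xs)"
  by (simp_all add: ipol_def)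

lemma Poly_pairs:
  "length hs \<le> length ps \<Longrightarrow> Poly (map (val c) (pairs ps hs)) = ipol ps - smult c (ipol hs)"
  by (induction ps hs rule: pairs.induct) auto

lemma logc_pairs:
  assumes "lc_pairs (pairs ps hs)" "length hs \<le> length ps" "0 \<le> c" "c \<le> 4"
  shows "logc (ipol ps - smult c (ipol hs))"
  using logc_Poly[OF lc_pairs[OF assms(3,4,1)]] Poly_pairs[OF assms(2)] by simp

fun ladd :: "int list \<Rightarrow> int list \<Rightarrow> int list" where
  "ladd (x # xs) (y # ys) = (x + y) # ladd xs ys"
| "ladd [] ys = ys"
| "ladd xs [] = xs"

fun lmul :: "int list \<Rightarrow> int list \<Rightarrow> int list" where
  "lmul (x # xs) ys = ladd (map ((*) x) ys) (0 # lmul xs ys)"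
| "lmul [] ys = []"

lemma ipol_ladd: "ipol (ladd xs ys) = ipol xs + ipol ys"
  by (induction xs ys rule: ladd.induct) auto

lemma ipol_map: "ipol (map ((*) a) ys) = smult (real_of_int a) (ipol ys)"
  by (induction ys) auto

lemma ipol_lmul: "ipol (lmul xs ys) = ipol xs * ipol ys"
  by (induction xs ys rule: lmul.induct) (auto simp: ipol_ladd ipol_map)

lemma ipol_shift: "ipol (0 # xs) = X * ipol xs"
  by (simp add: monom_altdef)

fun lpath :: "nat \<Rightarrow> int list" where
  "lpath 0 = [1]"
| "lpath (Suc 0) = [1, 1]"
| "lpath (Suc (Suc n)) = ladd (lpath (Suc n)) (0 # lpath n)"

lemma ipol_lpath: "ipol (lpath n) = pathpoly n"
  by (induction n rule: lpath.induct) (auto simp: ipol_ladd monom_altdef)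

text \<open>The quadratic factor of the concatenation of paths: \<open>g\<close> is
  \<open>pathpoly k\<close>, and \<open>h\<close> comes from
  \<open>setpoly_path_leaf\<close>.\<close>

definition pathQ :: "nat \<Rightarrow> real \<Rightarrow> real poly" where
  "pathQ k c = (pathpoly k)\<^sup>2 - smult c (X\<^sup>2 * pathpoly (k - 2) * pathpoly (k - 3))"

definition lpathP where "lpathP k = lmul (lpath k) (lpath k)"
definition lpathH where "lpathH k = 0 # 0 # lmul (lpath (k - 2)) (lpath (k - 3))"

lemma pathQ_lists: "pathQ k c = ipol (lpathP k) - smult c (ipol (lpathH k))"
  by (simp add: pathQ_def lpathP_def lpathH_def ipol_lmul ipol_lpath power2_eq_square monom_altdef)


text \<open>Evaluation of the list test, uniform in \<open>c\<close>. The values 3 and 5 are absent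
  because there log-concavity fails for \<open>c\<close> near 4.\<close>

lemma logc_pathQ_small:
  assumes "k \<in> {2, 4, 6, 7, 8, 9}" "0 \<le> c" "c \<le> 4"
  shows "logc (pathQ k c)"
proof -
  have "\<forall>k \<in> {2, 4, 6, 7, 8, 9}. lc_pairs (pairs (lpathP k) (lpathH k)) \<and> length (lpathH k) \<le> length (lpathP k)"
    by code_simp
  then show ?thesis
    using assms unfolding pathQ_lists by (intro logc_pairs) auto
qed

section \<open>Perturbations of ultra-log-concave polynomials\<close>

text \<open>After weighting by factorials the hypothesis is the adjacent inequality of
  \<open>logcI\<close>, which supplies the inequality at all distances.\<close>

lemma ulogcI:
  assumes pos: "\<And>i. i \<le> n \<Longrightarrow> 0 < coeff p i"
    and zero: "\<And>i. n < i \<Longrightarrow> coeff p i = 0"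
    and adj: "\<And>i. i + 2 \<le> n \<Longrightarrow> real (i + 2) * (coeff p i * coeff p (i + 2)) \<le> real (i + 1) * (coeff p (i + 1))\<^sup>2"
  shows "ulogc p"
proof -
  define b where "b = Poly (map (\<lambda>i. fact i * coeff p i) [0..<Suc n])"
  have b: "coeff b i = fact i * coeff p i" for i
    using zero[of i] by (auto simp: b_def nth_default_def simp del: upt_Suc)
  have "logc b"
  proof (rule logcI[where n = n])
    fix i assume i: "i + 2 \<le> n"
    have "coeff b i * coeff b (i + 2) = fact i * fact (i + 1) * (real (i + 2) * (coeff p i * coeff p (i + 2)))"
      by (simp add: b)
    also have "\<dots> \<le> fact i * fact (i + 1) * (real (i + 1) * (coeff p (i + 1))\<^sup>2)"
      by (intro mult_left_mono adj i) auto
    also have "\<dots> = (coeff b (i + 1))\<^sup>2"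
      by (simp add: b power2_eq_square algebra_simps)
    finally show "coeff b i * coeff b (i + 2) \<le> (coeff b (i + 1))\<^sup>2" .
  qed (use pos zero in \<open>auto simp: b intro!: mult_nonneg_nonneg less_imp_le\<close>)
  have "ratio_le (pderiv p) p"
    unfolding ratio_le_def
  proof (intro allI impI)
    fix r s :: nat
    assume "r < s"
    have "coeff b r * coeff b (r + 1 + (s - r)) \<le> coeff b (r + 1) * coeff b (r + (s - r))"
      by (rule logcD) fact
    then have "fact r * fact s * (coeff (pderiv p) s * coeff p r) \<le> fact r * fact s * (coeff (pderiv p) r * coeff p s)"
      using \<open>r < s\<close> by (simp add: b coeff_pderiv algebra_simps)
    then show "coeff (pderiv p) s * coeff p r \<le> coeff (pderiv p) r * coeff p s"
      by (simp add: mult_le_cancel_left)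
  qed
  moreover have "logc p"
  proof (rule logcI[where n = n])
    fix i assume i: "i + 2 \<le> n"
    have "0 \<le> coeff p i * coeff p (i + 2)"
      using pos[of i] pos[of "i + 2"] i by simp
    then have "real (i + 1) * (coeff p i * coeff p (i + 2)) \<le> real (i + 2) * (coeff p i * coeff p (i + 2))"
      by (intro mult_right_mono) auto
    also note adj[OF i]
    finally show "coeff p i * coeff p (i + 2) \<le> (coeff p (i + 1))\<^sup>2"
      by (simp add: mult_le_cancel_left)
  qed (use pos zero in \<open>auto intro: less_imp_le\<close>)
  ultimately show ?thesis by (simp add: ulogc_def)
qed

text \<open>Ultra-log-concavity leaves a slack factor (j+1)/(j+2). With u = 2j+3 this is
  (u-1)/(u+1), and times (1+1/u)^2 it is still below 1; so relative errors 1/u in the outer terms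
  are absorbed.\<close>

lemma ulogc_perturb_nonneg:
  fixes x0 x1 x2 y0 y1 y2 :: real
  assumes "real (j + 2) * (x0 * x2) \<le> real (j + 1) * x1\<^sup>2" "0 \<le> x0" "0 \<le> x1" "0 \<le> x2"
    and "0 \<le> y0" "0 \<le> y1" "0 \<le> y2"
    and y0: "real (2 * j + 3) * y0 \<le> x0" and y2: "real (2 * j + 3) * y2 \<le> x2"
  shows "(x0 + y0) * (x2 + y2) \<le> (x1 + y1)\<^sup>2"
proof -
  define u where "u = real (2 * j + 3)"
  have u: "0 < u" by (simp add: u_def)
  have "u * (x0 + y0) \<le> (u + 1) * x0" "u * (x2 + y2) \<le> (u + 1) * x2"
    using y0[folded u_def] y2[folded u_def] by (simp_all add: distrib_left distrib_right)
  then have "(u * (x0 + y0)) * (u * (x2 + y2)) \<le> ((u + 1) * x0) * ((u + 1) * x2)"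
    using assms(2-7) u by - (rule mult_mono, auto)
  then have "u\<^sup>2 * ((x0 + y0) * (x2 + y2)) \<le> (u + 1)\<^sup>2 * (x0 * x2)"
    by (simp add: power2_eq_square mult_ac)
  also have "\<dots> = 4 * real (j + 2) * (real (j + 2) * (x0 * x2))"
    by (simp add: u_def power2_eq_square algebra_simps)
  also have "\<dots> \<le> 4 * real (j + 2) * (real (j + 1) * x1\<^sup>2)"
    by (intro mult_left_mono assms(1)) auto
  also have "\<dots> = (u\<^sup>2 - 1) * x1\<^sup>2"
    by (simp add: u_def power2_eq_square algebra_simps)
  also have "\<dots> \<le> u\<^sup>2 * x1\<^sup>2"
    by (intro mult_right_mono) auto
  finally have "(x0 + y0) * (x2 + y2) \<le> x1\<^sup>2"
    using u by simp
  also have "\<dots> \<le> (x1 + y1)\<^sup>2"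
    using assms by (intro power_mono) auto
  finally show ?thesis .
qed

text \<open>Here the middle term may shrink as well. With u = 4j+8 the slack is (u-4)/u, and the
  claim reduces to (u-4)(u+1)^2 being at most u(u-1)^2; the difference is 8u+4.\<close>

lemma ulogc_perturb:
  fixes x0 x1 x2 y0 y1 y2 :: real
  assumes "real (j + 2) * (x0 * x2) \<le> real (j + 1) * x1\<^sup>2" "0 \<le> x0" "0 \<le> x1" "0 \<le> x2"
    and y0: "real (4 * j + 8) * \<bar>y0\<bar> \<le> x0" and y1: "real (4 * j + 8) * \<bar>y1\<bar> \<le> x1"
    and y2: "real (4 * j + 8) * \<bar>y2\<bar> \<le> x2"
  shows "(x0 + y0) * (x2 + y2) \<le> (x1 + y1)\<^sup>2"
proof -
  define u where "u = real (4 * j + 8)"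
  have u: "8 \<le> u" by (simp add: u_def)
  have m: "u * y \<le> u * \<bar>y\<bar>" "- (u * \<bar>y\<bar>) \<le> u * y" for y :: real
    using u by (auto simp: abs_if)
  note y = y0[folded u_def] y1[folded u_def] y2[folded u_def]
  have "\<bar>y2\<bar> \<le> u * \<bar>y2\<bar>" using u mult_right_mono[of 1 u "\<bar>y2\<bar>"] by simp
  then have "0 \<le> x2 + y2" using y(3) by linarith
  moreover have "u * (x0 + y0) \<le> (u + 1) * x0" "u * (x2 + y2) \<le> (u + 1) * x2"
    using y m[of y0] m[of y2] unfolding distrib_left distrib_right by linarith+
  ultimately have "(u * (x0 + y0)) * (u * (x2 + y2)) \<le> ((u + 1) * x0) * ((u + 1) * x2)"
    using assms(2-4) u by - (rule mult_mono, auto)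
  then have "u\<^sup>2 * ((x0 + y0) * (x2 + y2)) \<le> (u + 1)\<^sup>2 * (x0 * x2)"
    by (simp add: power2_eq_square mult_ac)
  then have "u * (u\<^sup>2 * ((x0 + y0) * (x2 + y2))) \<le> u * ((u + 1)\<^sup>2 * (x0 * x2))"
    using u by (intro mult_left_mono) auto
  also have "\<dots> = 4 * (u + 1)\<^sup>2 * (real (j + 2) * (x0 * x2))"
    by (simp add: u_def power2_eq_square algebra_simps)
  also have "\<dots> \<le> 4 * (u + 1)\<^sup>2 * (real (j + 1) * x1\<^sup>2)"
    by (intro mult_left_mono assms(1)) auto
  also have "\<dots> = (u - 4) * (u + 1)\<^sup>2 * x1\<^sup>2"
    by (simp add: u_def power2_eq_square algebra_simps)
  also have "\<dots> \<le> u * (u - 1)\<^sup>2 * x1\<^sup>2"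
  proof -
    have "u * (u - 1)\<^sup>2 - (u - 4) * (u + 1)\<^sup>2 = 8 * u + 4"
      by (simp add: power2_eq_square algebra_simps)
    then show ?thesis using u by (intro mult_right_mono) auto
  qed
  also have "\<dots> = u * ((u - 1) * x1)\<^sup>2"
    by (simp add: power_mult_distrib)
  also have "\<dots> \<le> u * (u * (x1 + y1))\<^sup>2"
  proof (intro mult_left_mono power_mono)
    show "(u - 1) * x1 \<le> u * (x1 + y1)"
      using y m[of y1] unfolding distrib_left left_diff_distrib by linarith
  qed (use u assms(3) in auto)
  finally have "(u * u\<^sup>2) * ((x0 + y0) * (x2 + y2)) \<le> (u * u\<^sup>2) * (x1 + y1)\<^sup>2"
    by (simp add: power_mult_distrib mult_ac)
  then show ?thesis
    using u by (simp add: mult_le_cancel_left)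
qed

lemma binomial_absorb: "real (k + 1) * real (n choose (k + 1)) = (real n - real k) * real (n choose k)" if "k \<le> n"
proof -
  have "(k + 1) * (n choose (k + 1)) = (n - k) * (n choose k)"
    using binomial_absorb_comp[of n k] binomial_absorption[of k n] by simp
  then show ?thesis
    using that by (metis of_nat_diff of_nat_mult)
qed

lemma coeff_X1_power: "coeff (X1 ^ n) i = real (n choose i)"
  by (cases "i \<le> n") (simp_all add: coeff_linear_poly_power coeff_eq_0 degree_linear_power)

lemma ulogc_X1: "ulogc X1"
  by (rule ulogcI[where n = 1]) (auto simp: coeff_pCons split: nat.splits)

text \<open>The extra \<open>X\<close> changes only coefficient 1. It helps for
  \<open>i = 0\<close>, is absent for \<open>i\<close> at least 2, and for \<open>i = 1\<close> the
  claim reduces to (l+1)(l-2) being at most l(l-1).\<close>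

lemma ulogc_X1_power_add: "ulogc (X1 ^ l + X)"
proof (rule ulogcI[where n = "max 1 l"])
  have c: "coeff (X1 ^ l + X) i = real (l choose i) + (if i = 1 then 1 else 0)" for i
    by (simp add: coeff_X1_power)
  show "0 < coeff (X1 ^ l + X) i" if "i \<le> max 1 l" for i
    using that by (cases "i \<le> l") (auto simp: coeff_X1_power max_def split: if_splits)
  show "coeff (X1 ^ l + X) i = 0" if "max 1 l < i" for i
    using that by (auto simp: coeff_X1_power)
  fix i assume "i + 2 \<le> max 1 l"
  then have i: "i + 2 \<le> l" by auto
  note r = binomial_absorb[of _ l]
  show "real (i + 2) * (coeff (X1 ^ l + X) i * coeff (X1 ^ l + X) (i + 2))
      \<le> real (i + 1) * (coeff (X1 ^ l + X) (i + 1))\<^sup>2"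
  proof -
    consider "i = 0" | "i = 1" | "2 \<le> i" by linarith
    then show ?thesis
    proof cases
      case 1
      have "2 * real (l choose 2) = (real l - 1) * real l"
        using r[of 1] r[of 0] i by (simp add: numeral_2_eq_2)
      then show ?thesis unfolding 1 c by (simp add: numeral_2_eq_2 power2_eq_square algebra_simps)
    next
      case 2
      have 3: "3 * real (l choose 3) = (real l - 2) * real (l choose 2)"
        using r[of 2] i by (simp add: eval_nat_numeral)
      have 22: "2 * real (l choose 2) = (real l - 1) * real l"
        using r[of 1] r[of 0] i by (simp add: numeral_2_eq_2)
      have "(real l + 1) * (3 * real (l choose 3)) = ((real l + 1) * (real l - 2)) * real (l choose 2)"
        by (simp add: 3)
      also have "\<dots> \<le> (2 * real (l choose 2)) * real (l choose 2)"
        unfolding 22 by (intro mult_right_mono) (auto simp: algebra_simps)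
      finally show ?thesis unfolding 2 c
        by (simp add: eval_nat_numeral algebra_simps)
    next
      case 3
      have "real (i + 2) * (real (l choose i) * real (l choose (i + 2)))
          = real (l choose i) * ((real l - real (i + 1)) * real (l choose (i + 1)))"
        using r[of "i + 1"] i by (simp add: mult_ac)
      also have "\<dots> \<le> ((real l - real i) * real (l choose i)) * real (l choose (i + 1))"
        by (simp add: algebra_simps mult_left_mono)
      also have "\<dots> = real (i + 1) * (real (l choose (i + 1)))\<^sup>2"
        using r[of i] i by (simp add: power2_eq_square mult_ac)
      finally show ?thesis unfolding c using 3 by simp
    qed
  qed
qed


section \<open>The quadratic factors of double stars\<close>

lemma real_choose_two: "real (n choose 2) = real n * (real n - 1) / 2"
  using binomial_absorb[of 1 n] by (cases "n = 0") (auto simp: numeral_2_eq_2 algebra_simps)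

lemma real_choose_three: "real (n choose 3) = real n * (real n - 1) * (real n - 2) / 6"
proof (cases "2 \<le> n")
  case True
  then have "3 * real (n choose 3) = (real n - 2) * real (n choose 2)"
    using binomial_absorb[of 2 n] by (simp add: eval_nat_numeral)
  then show ?thesis by (simp add: real_choose_two mult_ac)
next
  case False
  then have "n = 0 \<or> n = 1" by linarith
  then show ?thesis by auto
qed

text \<open>Induction step for the two domination lemmas: the last assumption compares the growth
  from \<open>k\<close> to \<open>k + 1\<close> of the two sides, including their weights.\<close>

lemma binomial_ratio_step:
  fixes w w' :: real
  assumes "k < m" "k < n" "w * real (n choose k) \<le> real (m choose (k + 1))" "0 \<le> w"
    and "w' * (real n - real k) * real (k + 2) \<le> w * (real m - real k - 1) * real (k + 1)"
  shows "w' * real (n choose (k + 1)) \<le> real (m choose (k + 2))"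
proof -
  have m: "real (k + 2) * real (m choose (k + 2)) = (real m - real k - 1) * real (m choose (k + 1))"
    using binomial_absorb[of "k + 1" m] assms(1) by simp
  have n: "real (k + 1) * real (n choose (k + 1)) = (real n - real k) * real (n choose k)"
    using binomial_absorb[of k n] assms(2) by simp
  have "real (k + 1) * real (k + 2) * (w' * real (n choose (k + 1)))
      = w' * real (k + 2) * (real (k + 1) * real (n choose (k + 1)))"
    by (simp add: mult_ac)
  also have "\<dots> = (w' * (real n - real k) * real (k + 2)) * real (n choose k)"
    unfolding n by (simp add: mult_ac)
  also have "\<dots> \<le> (w * (real m - real k - 1) * real (k + 1)) * real (n choose k)"
    by (intro mult_right_mono assms) auto
  also have "\<dots> = ((real m - real k - 1) * real (k + 1)) * (w * real (n choose k))"
    by (simp add: mult_ac)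
  also have "\<dots> \<le> ((real m - real k - 1) * real (k + 1)) * real (m choose (k + 1))"
    using assms(1) by (intro mult_left_mono assms mult_nonneg_nonneg) auto
  also have "\<dots> = real (k + 1) * real (k + 2) * real (m choose (k + 2))"
    using m by (simp add: mult_ac)
  finally show ?thesis
    by (simp add: mult_le_cancel_left)
qed

text \<open>With \<open>i = k + 1\<close> the weight is twice the \<open>4 * i + 8\<close> of
  \<open>ulogc_perturb\<close>. The base case \<open>k = 1\<close> dictates the bound 17.\<close>

lemma binomial_dominates_A:
  assumes "1 \<le> k" "17 \<le> m"
  shows "real (8 * k + 24) * real (m choose k) \<le> real (2 * m choose (k + 1))"
  using assms(1)
proof (induction k rule: dec_induct)
  case base
  have "32 * real m \<le> real m * (2 * real m - 1)"
    using assms(2) by (simp add: mult.commute[of "real m"] mult_right_mono)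
  then show ?case
    using real_choose_two[of "2 * m"] by (simp add: numeral_2_eq_2)
next
  case (step n)
  show ?case
  proof (cases "n < m")
    case True
    have "real (8 * n + 32) * (real m - real n) * real (n + 2) \<le> real (8 * n + 24) * (real (2 * m) - real n - 1) * real (n + 1)"
    proof -
      \<comment> \<open>After this shift the difference of the two sides has nonnegative
        coefficients in \<open>p\<close> and \<open>q\<close>.\<close>
      obtain p q where "n = 1 + p" "m = 17 + q"
        using step(1) assms(2) by (metis le_iff_add)
      then show ?thesis by (simp add: algebra_simps)
    qed
    then show ?thesis
      using binomial_ratio_step[of n "2 * m" m "real (8 * n + 24)" "real (8 * n + 32)"] step True
      by (simp add: add.commute)
  qed (simp add: binomial_eq_0)
qed

text \<open>With \<open>i = k + 1\<close> the weight is twice the \<open>2 * i + 3\<close> of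
  \<open>ulogc_perturb_nonneg\<close>. The base case \<open>k = 2\<close> dictates the bound
  9.\<close>

lemma binomial_dominates_B:
  assumes "2 \<le> k" "9 \<le> m"
  shows "real (4 * k + 10) * real ((m + 1) choose k) \<le> real (2 * m choose (k + 1))"
  using assms(1)
proof (induction k rule: dec_induct)
  case base
  obtain q where q: "m = 9 + q" using assms(2) by (metis le_iff_add)
  have c: "real (2 * m choose 3) = (18 + 2 * real q) * (17 + 2 * real q) * (16 + 2 * real q) / 6"
    "real (m + 1 choose 2) = (10 + real q) * (9 + real q) / 2"
    unfolding real_choose_two real_choose_three by (simp_all add: q algebra_simps)
  have "18 * ((10 + real q) * (9 + real q) / 2) \<le> (18 + 2 * real q) * (17 + 2 * real q) * (16 + 2 * real q) / 6"
    by (simp add: algebra_simps)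
  then show ?case using c by (simp add: eval_nat_numeral)
next
  case (step n)
  show ?case
  proof (cases "n < m + 1")
    case True
    have "real (4 * n + 14) * (real (m + 1) - real n) * real (n + 2) \<le> real (4 * n + 10) * (real (2 * m) - real n - 1) * real (n + 1)"
    proof -
      obtain p q where "n = 2 + p" "m = 9 + q"
        using step(1) assms(2) by (metis le_iff_add)
      then show ?thesis by (simp add: algebra_simps)
    qed
    then show ?thesis
      using binomial_ratio_step[of n "2 * m" "m + 1" "real (4 * n + 10)" "real (4 * n + 14)"] step True assms(2)
      by (simp add: add.commute)
  qed (simp add: binomial_eq_0 del: binomial_Suc_Suc)
qed

text \<open>What remains of g^2 - c h after removing a power of \<open>X1\<close>: \<open>L\<close>
  is the larger number of leaves at a center and \<open>d\<close> the difference of the two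
  numbers.\<close>

definition starR :: "nat \<Rightarrow> nat \<Rightarrow> real \<Rightarrow> real poly" where
  "starR L d c = X1 ^ (2 * L) + X * smult 2 (X1 ^ L + X1 ^ (L + d))
     + X\<^sup>2 * (X1 ^ (2 * d) + 1 + smult (2 - c) (X1 ^ d))"

lemma X_sq: "X\<^sup>2 = monom 1 2"
  by (simp add: power2_eq_square mult_monom numeral_2_eq_2)

text \<open>\<open>starX\<close> is the ultra-log-concave main part of \<open>starR\<close>, a
  square; \<open>starY\<close> collects the other terms, which carry the dependence on
  \<open>c\<close>.\<close>

definition starX :: "nat \<Rightarrow> nat \<Rightarrow> nat \<Rightarrow> real" where
  "starX L d i = coeff ((X1 ^ d * (X1 ^ (L - d) + X))\<^sup>2) i"

definition starY :: "nat \<Rightarrow> nat \<Rightarrow> real \<Rightarrow> nat \<Rightarrow> real" where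
  "starY L d c i = coeff (X * smult 2 (X1 ^ L) + X\<^sup>2 * (1 + smult (2 - c) (X1 ^ d))) i"

lemma smult_two: "smult 2 p = p + (p :: real poly)"
  using smult_add_left[of 1 1 p] unfolding one_add_one smult_1_left .

lemma starX_square: "d \<le> L \<Longrightarrow> (X1 ^ d * (X1 ^ (L - d) + X))\<^sup>2
    = X1 ^ (2 * L) + X * smult 2 (X1 ^ (L + d)) + X\<^sup>2 * X1 ^ (2 * d)"
proof -
  assume "d \<le> L"
  then obtain l where "L = d + l" by (metis le_iff_add)
  have e: "(A * (B + Z))\<^sup>2 = A\<^sup>2 * B\<^sup>2 + Z * (A * (A * B) + A * (A * B)) + Z\<^sup>2 * A\<^sup>2" for A B Z :: "real poly"
    by (simp add: power2_eq_square algebra_simps)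
  have "X1 ^ (2 * L) = (X1 ^ d)\<^sup>2 * (X1 ^ l)\<^sup>2" "X1 ^ (2 * d) = (X1 ^ d)\<^sup>2" "L - d = l"
    unfolding \<open>L = d + l\<close> by (simp_all only: power_even_eq power_add power_mult_distrib diff_add_inverse)
  moreover have "X1 ^ (L + d) = X1 ^ d * (X1 ^ d * X1 ^ l)"
    unfolding \<open>L = d + l\<close> by (simp only: power_add mult_ac)
  ultimately show ?thesis
    by (simp only: e smult_two)
qed

lemma coeff_starR: "d \<le> L \<Longrightarrow> coeff (starR L d c) i = starX L d i + starY L d c i"
  unfolding starX_def starY_def starX_square starR_def coeff_add[symmetric]
  by (rule arg_cong[where f = "\<lambda>p. coeff p i"]) (simp only: smult_add_right distrib_left add_ac)

lemma starX: "d \<le> L \<Longrightarrow> starX L d i = real (2 * L choose i)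
    + (if i = 0 then 0 else 2 * real (L + d choose (i - 1))) + (if i < 2 then 0 else real (2 * d choose (i - 2)))"
  unfolding starX_def starX_square X_sq
  by (auto simp: coeff_monom_mult coeff_X1_power not_less)

lemma starY: "starY L d c i = (if i = 0 then 0 else 2 * real (L choose (i - 1)))
    + (if i < 2 then 0 else (if i = 2 then 1 else 0) + (2 - c) * real (d choose (i - 2)))"
  unfolding starY_def X_sq by (auto simp: coeff_monom_mult coeff_X1_power not_less coeff_1)

lemma starX_adj:
  "real (j + 2) * (starX L d j * starX L d (j + 2)) \<le> real (j + 1) * (starX L d (j + 1))\<^sup>2"
  unfolding starX_def
  unfolding power2_eq_square[of "_ * _ :: real poly"]
  by (intro ulogc_adj ulogc_mult ulogc_power ulogc_X1 ulogc_X1_power_add)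

text \<open>Since \<open>d < L\<close>, Pascal's rule lets the term
  \<open>2 * real (L choose k)\<close> compensate a negative factor \<open>2 - c\<close>. So the
  perturbation is nonnegative, and the weaker requirement of \<open>ulogc_perturb_nonneg\<close>
  suffices.\<close>

lemma logc_starR_B:
  assumes "9 \<le> L" "d < L" "0 \<le> c" "c \<le> 4"
  shows "logc (starR L d c)"
proof -
  have dL: "d \<le> L" using assms by simp
  have X0: "0 \<le> starX L d i" for i
    by (simp add: starX dL)
  obtain L' where L': "L = Suc L'" using assms(1) by (cases L) auto
  have Y: "0 \<le> starY L d c i \<and> real (2 * i + 3) * starY L d c i \<le> starX L d i" for i
  proof -
    consider "i = 0" | "i = 1" | "i = 2" | k where "i = k + 1" "2 \<le> k"
      by (metis One_nat_def Suc_eq_plus1 Suc_leI le_neq_implies_less not0_implies_Suc numeral_2_eq_2 zero_less_Suc nat_less_le)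
    then show ?thesis
    proof cases
      case 1 then show ?thesis by (simp add: starX[OF dL] starY)
    next
      case 2 then show ?thesis using assms(1) by (simp add: starX[OF dL] starY)
    next
      case 3
      have c2: "real (2 * L choose 2) = real L * (2 * real L - 1)"
        by (simp add: real_choose_two)
      have "7 * (2 * real L + 3) \<le> real L * (2 * real L - 1) + 2 * real L"
      proof -
        obtain q where "L = 9 + q" using assms(1) by (metis le_iff_add)
        then show ?thesis by (simp add: algebra_simps)
      qed
      then show ?thesis using assms c2 by (simp add: 3 starX[OF dL] starY algebra_simps)
    next
      case (4 k)
      have m: "real (d choose (k - 1)) \<le> real (L' choose (k - 1))"
        using assms(2) L' by (simp add: binomial_right_mono)
      have p: "real (L choose k) = real (L' choose (k - 1)) + real (L' choose k)"
        "real (L + 1 choose k) = real (L choose (k - 1)) + real (L choose k)"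
        using 4 L' by (cases k; simp)+
      have p': "real (L' choose (k - 1)) \<le> real (L choose (k - 1))"
        using L' by (simp add: binomial_right_mono)
      have c: "(2 - c) * real (d choose (k - 1)) \<le> 2 * real (d choose (k - 1))"
        "- 2 * real (d choose (k - 1)) \<le> (2 - c) * real (d choose (k - 1))"
        using mult_right_mono[of "2 - c" 2 "real (d choose (k - 1))"]
          mult_right_mono[of "- 2" "2 - c" "real (d choose (k - 1))"] assms(3,4) by auto
      have y: "starY L d c i = 2 * real (L choose k) + (2 - c) * real (d choose (k - 1))"
        using 4 by (simp add: starY)
      have nn: "0 \<le> starY L d c i" unfolding y using c m p by linarith
      have "starY L d c i \<le> 2 * real (L + 1 choose k)"
        unfolding y using c m p p' by linarith
      then have "real (2 * i + 3) * starY L d c i \<le> real (2 * i + 3) * (2 * real (L + 1 choose k))"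
        by (intro mult_left_mono) auto
      also have "\<dots> = real (4 * k + 10) * real (L + 1 choose k)"
        using 4 by (simp add: algebra_simps)
      also have "\<dots> \<le> real (2 * L choose (k + 1))"
        by (rule binomial_dominates_B) (use 4 assms in auto)
      also have "\<dots> \<le> starX L d i"
        using 4 by (simp add: starX[OF dL])
      finally show ?thesis using nn by simp
    qed
  qed
  show ?thesis
  proof (rule logcI[where n = "2 * L"])
    have pos: "0 < coeff (starR L d c) i" if "i \<le> 2 * L" for i
    proof -
      have "0 < real (2 * L choose i)" using that by simp
      then have "0 < starX L d i" unfolding starX[OF dL] by (smt (verit) of_nat_0_le_iff)
      then show ?thesis using Y[of i] by (simp add: coeff_starR[OF dL])
    qed
    then show "0 < coeff (starR L d c) i" if "i < 2 * L" for i using that by simp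
    show "0 \<le> coeff (starR L d c) (2 * L)" using pos[of "2 * L"] by simp
    show "coeff (starR L d c) i = 0" if "2 * L < i" for i
      using that assms by (simp add: coeff_starR[OF dL] starX[OF dL] starY binomial_eq_0)
    show "coeff (starR L d c) i * coeff (starR L d c) (i + 2) \<le> (coeff (starR L d c) (i + 1))\<^sup>2" for i
      unfolding coeff_starR[OF dL]
    proof (rule ulogc_perturb_nonneg[OF starX_adj])
      have "real (2 * i + 3) * starY L d c (i + 2) \<le> real (2 * (i + 2) + 3) * starY L d c (i + 2)"
        using Y by (intro mult_right_mono) auto
      then show "real (2 * i + 3) * starY L d c (i + 2) \<le> starX L d (i + 2)"
        using Y[of "i + 2"] by linarith
    qed (use X0 Y in auto)
  qed
qed

text \<open>For \<open>d = L\<close> the main part is a power of \<open>X1\<close>, but the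
  perturbation can be negative; the two-sided estimate costs the larger bound on
  \<open>L\<close>.\<close>

lemma logc_starR_A:
  assumes "17 \<le> L" "0 \<le> c" "c \<le> 4"
  shows "logc (starR L L c)"
proof -
  have "X1 ^ (L - L) + X = X1"
    by (simp add: monom_altdef one_pCons)
  then have "(X1 ^ L * (X1 ^ (L - L) + X))\<^sup>2 = X1 ^ (2 * L + 2)"
    by (metis power_add power_mult_distrib power_even_eq)
  then have X: "starX L L i = real (2 * L + 2 choose i)" for i
    unfolding starX_def by (simp only: coeff_X1_power)
  have Y: "real (4 * i + 8) * \<bar>starY L L c i\<bar> \<le> starX L L i" for i
  proof -
    consider "i = 0" | "i = 1" | "i = 2" | k where "i = k + 1" "2 \<le> k"
      by (metis One_nat_def Suc_eq_plus1 Suc_leI le_neq_implies_less not0_implies_Suc numeral_2_eq_2 zero_less_Suc nat_less_le)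
    then show ?thesis
    proof cases
      case 1 then show ?thesis by (simp add: X starY)
    next
      case 2 then show ?thesis using assms(1) by (simp add: X starY)
    next
      case 3
      have c2: "real (2 * L + 2 choose 2) = (real L + 1) * (2 * real L + 1)"
        using real_choose_two[of "2 * L + 2"] by (simp add: algebra_simps)
      have "16 * (2 * real L + 3) \<le> (real L + 1) * (2 * real L + 1)"
      proof -
        obtain q where "L = 17 + q" using assms(1) by (metis le_iff_add)
        then show ?thesis by (simp add: algebra_simps)
      qed
      then show ?thesis using assms c2 by (simp add: 3 X starY)
    next
      case (4 k)
      have p: "real (L + 1 choose k) = real (L choose (k - 1)) + real (L choose k)"
        using 4 by (cases k; simp)
      have c: "(2 - c) * real (L choose (k - 1)) \<le> 2 * real (L choose (k - 1))"
        "- 2 * real (L choose (k - 1)) \<le> (2 - c) * real (L choose (k - 1))"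
        using mult_right_mono[of "2 - c" 2 "real (L choose (k - 1))"]
          mult_right_mono[of "- 2" "2 - c" "real (L choose (k - 1))"] assms(2,3) by auto
      have y: "starY L L c i = 2 * real (L choose k) + (2 - c) * real (L choose (k - 1))"
        using 4 by (simp add: starY)
      have "\<bar>starY L L c i\<bar> \<le> 2 * real (L + 1 choose k)"
        unfolding y abs_le_iff using c p by (auto simp: algebra_simps)
      then have "real (4 * i + 8) * \<bar>starY L L c i\<bar> \<le> real (4 * i + 8) * (2 * real (L + 1 choose k))"
        by (intro mult_left_mono) auto
      also have "\<dots> = real (8 * k + 24) * real (L + 1 choose k)"
        using 4 by (simp add: algebra_simps)
      also have "\<dots> \<le> real (2 * (L + 1) choose (k + 1))"
        by (rule binomial_dominates_A) (use 4 assms in auto)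
      finally show ?thesis using 4 by (simp add: X)
    qed
  qed
  show ?thesis
  proof (rule logcI[where n = "2 * L + 2"])
    have pos: "0 < coeff (starR L L c) i" if "i \<le> 2 * L + 2" for i
    proof -
      have x: "0 < starX L L i" using that by (simp add: X)
      have "1 * \<bar>starY L L c i\<bar> < real (4 * i + 8) * \<bar>starY L L c i\<bar> \<or> starY L L c i = 0"
        by (auto simp: mult_less_cancel_right)
      then show ?thesis using Y[of i] x unfolding coeff_starR[OF order_refl] by linarith
    qed
    then show "0 < coeff (starR L L c) i" if "i < 2 * L + 2" for i using that by simp
    show "0 \<le> coeff (starR L L c) (2 * L + 2)" using pos[of "2 * L + 2"] by simp
    show "coeff (starR L L c) i = 0" if "2 * L + 2 < i" for i
      using that by (simp add: coeff_starR X starY binomial_eq_0)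
    show "coeff (starR L L c) i * coeff (starR L L c) (i + 2) \<le> (coeff (starR L L c) (i + 1))\<^sup>2" for i
      unfolding coeff_starR[OF order_refl]
    proof (rule ulogc_perturb[OF starX_adj])
      have w: "real (4 * i + 8) * \<bar>starY L L c k\<bar> \<le> starX L L k" if "i \<le> k" for k
      proof -
        have "real (4 * i + 8) * \<bar>starY L L c k\<bar> \<le> real (4 * k + 8) * \<bar>starY L L c k\<bar>"
          using that by (intro mult_right_mono) auto
        then show ?thesis using Y[of k] by linarith
      qed
      show "real (4 * i + 8) * \<bar>starY L L c i\<bar> \<le> starX L L i"
        "real (4 * i + 8) * \<bar>starY L L c (i + 1)\<bar> \<le> starX L L (i + 1)"
        "real (4 * i + 8) * \<bar>starY L L c (i + 2)\<bar> \<le> starX L L (i + 2)"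
        by (rule w, simp)+
    qed (auto simp: X)
  qed
qed


section \<open>Verification of the small double stars\<close>

definition lstep :: "int list \<Rightarrow> int list" where "lstep r = ladd r (0 # r)"

primrec lrow :: "nat \<Rightarrow> int list" where
  "lrow 0 = [1]"
| "lrow (Suc n) = lstep (lrow n)"

lemma ipol_lrow: "ipol (lrow n) = X1 ^ n"
  by (induction n) (simp_all add: lstep_def ipol_ladd one_pCons)

lemma length_ladd: "length (ladd xs ys) = max (length xs) (length ys)"
  by (induction xs ys rule: ladd.induct) auto

lemma length_lrow: "length (lrow n) = Suc n"
  by (induction n) (simp_all add: lstep_def length_ladd)

definition lstarP :: "nat \<Rightarrow> nat \<Rightarrow> int list" where
  "lstarP L d = ladd (lrow (2 * L)) (0 # ladd (map ((*) 2) (ladd (lrow L) (lrow (L + d))))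
      (0 # ladd (ladd (lrow (2 * d)) [1]) (map ((*) 2) (lrow d))))"

definition lstarH :: "nat \<Rightarrow> int list" where
  "lstarH d = 0 # 0 # lrow d"

lemma starR_lists: "starR L d c = ipol (lstarP L d) - smult c (ipol (lstarH d))"
proof -
  have "ipol [1] = 1" by (simp add: one_pCons)
  then show ?thesis
    by (simp only: lstarP_def lstarH_def starR_def ipol_ladd ipol_shift ipol_lrow ipol_map
        power2_eq_square smult_diff_left of_int_numeral)
      (simp only: algebra_simps smult_add_right mult_smult_right mult_smult_left)
qed

definition star_check :: "nat \<Rightarrow> nat \<Rightarrow> bool" where
  "star_check L d \<longleftrightarrow> lc_pairs (pairs (lstarP L d) (lstarH d))"

lemma logc_star_check:
  "star_check L d \<Longrightarrow> 0 \<le> c \<Longrightarrow> c \<le> 4 \<Longrightarrow> logc (starR L d c)"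
  unfolding starR_lists star_check_def
  by (rule logc_pairs) (simp_all add: lstarP_def lstarH_def length_ladd length_lrow)

text \<open>The omitted pair has leaf numbers 0 and 1, so the star is the path on three vertices,
  where the test fails for \<open>c\<close> near 4.\<close>

lemma star_checks_small:
  "\<forall>d \<in> set [0..<9]. \<forall>L \<in> set [d..<9]. (L, d) = (1, 1) \<or> star_check L d"
  by code_simp

text \<open>The gap between the estimates: \<open>logc_starR_B\<close> excludes
  \<open>d = L\<close>, and \<open>logc_starR_A\<close> starts at 17.\<close>

lemma star_checks_diagonal:
  "\<forall>L \<in> set [9..<17]. star_check L L"
  by code_simp

lemma logc_starR:
  assumes "d \<le> L" "(L, d) \<noteq> (1, 1)" "0 \<le> c" "c \<le> 4"
  shows "logc (starR L d c)"
proof -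
  consider "L < 9" | "9 \<le> L" "d < L" | "9 \<le> L" "L < 17" "d = L" | "17 \<le> L" "d = L"
    using assms(1) by linarith
  then show ?thesis
  proof cases
    case 1
    then have "d \<in> set [0..<9]" "L \<in> set [d..<9]" using assms(1) by auto
    then have "star_check L d" using star_checks_small assms(2) by blast
    then show ?thesis using assms by (intro logc_star_check)
  next
    case 3
    then have "L \<in> set [9..<17]" unfolding set_upt by simp
    then have "star_check L d" using star_checks_diagonal \<open>d = L\<close> by blast
    then show ?thesis using assms by (intro logc_star_check)
  qed (use assms in \<open>auto intro: logc_starR_A logc_starR_B\<close>)
qed

text \<open>With \<open>A\<close> and \<open>B\<close> the powers \<open>l\<close> and
  \<open>d\<close> of \<open>X1\<close>, every term of both \<open>g\<^sup>2\<close> and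
  \<open>h\<close> contains \<open>A\<^sup>2\<close>.\<close>

lemma double_star_factor:
  fixes l d :: nat
  defines "g \<equiv> X1 ^ (l + (l + d)) + X * (X1 ^ l + X1 ^ (l + d))"
  shows "g\<^sup>2 - smult c (X\<^sup>2 * X1 ^ (l + (l + d))) = X1 ^ (2 * l) * starR (l + d) d c"
proof -
  have e: "(A * A * B + Z * (A + A * B))\<^sup>2 - smult c (Z\<^sup>2 * (A * A * B))
      = A\<^sup>2 * ((A * B)\<^sup>2 + Z * smult 2 (A * B + A * B * B) + Z\<^sup>2 * (B\<^sup>2 + 1 + smult (2 - c) B))" for A B Z :: "real poly"
    by (simp only: smult_diff_left smult_two smult_add_right power2_eq_square algebra_simps mult_smult_right mult_smult_left)
  show ?thesis
    unfolding g_def starR_def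
    using e[of "X1 ^ l" "X1 ^ d" X]
    by (simp only: power_even_eq power_add power_mult_distrib mult.assoc)
qed

section \<open>The quadratic factors of paths\<close>

text \<open>Cassini's identity for Fibonacci polynomials; one step of the recurrence multiplies the
  left side by \<open>- X\<close>.\<close>

lemma cassini: "(pathpoly (Suc n))\<^sup>2 - pathpoly (Suc (Suc n)) * pathpoly n = (- X) ^ (n + 2)"
proof (induction n)
  case 0
  show ?case by (simp add: monom_altdef power2_eq_square one_pCons)
next
  case (Suc n)
  have "B\<^sup>2 - (B + x * A) * A = - x * (A\<^sup>2 - B * Z)" if "B = A + x * Z" for A B Z x :: "real poly"
    by (simp add: that power2_eq_square algebra_simps)
  from this[of "pathpoly (Suc (Suc n))" "pathpoly (Suc n)" X "pathpoly n"]
  show ?case using Suc by simp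
qed

text \<open>The half step between \<open>pathQ m\<close> and \<open>pathQ (Suc m)\<close>: products
  of neighbouring path polynomials replace squares and vice versa.\<close>

definition pathQ' :: "nat \<Rightarrow> real \<Rightarrow> real poly" where
  "pathQ' m c = pathpoly (Suc m) * pathpoly m - smult c (X\<^sup>2 * (pathpoly (m - 2))\<^sup>2)"

text \<open>One of the two products of path polynomials fits the recurrence only after a square is
  exchanged for the product of its neighbours. Cassini makes the cost of that exchange a
  monomial.\<close>

lemma pathQ_rec:
  assumes "3 \<le> m"
  shows "pathQ (Suc m) c = pathQ' m c + X * pathQ m c + (- X) ^ (m + 2)"
proof -
  obtain n where m: "m = Suc (Suc (Suc n))"
    using assms by (auto dest: le_Suc_ex simp: numeral_3_eq_3)
  define A B Z W where "A = pathpoly (Suc m)" and "B = pathpoly m" and "Z = pathpoly (m - 1)" and "W = pathpoly n"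
  define U V where "U = pathpoly (Suc n)" and "V = pathpoly (Suc (Suc n))"
  have A: "A = B + X * V" and V: "V = U + X * W"
    by (simp_all add: A_def B_def V_def U_def W_def m)
  have "(- X) ^ (m + 2) = - X * (B\<^sup>2 - A * V)"
    using cassini[of "Suc (Suc n)"] by (simp add: m A_def B_def V_def)
  moreover have "pathQ (Suc m) c = A\<^sup>2 - smult c (X\<^sup>2 * V * U)"
    "pathQ' m c = A * B - smult c (X\<^sup>2 * U\<^sup>2)" "pathQ m c = B\<^sup>2 - smult c (X\<^sup>2 * U * W)"
    by (simp_all add: pathQ_def pathQ'_def m A_def B_def U_def V_def W_def numeral_2_eq_2 numeral_3_eq_3)
  moreover have "A\<^sup>2 - smult c (X\<^sup>2 * V * U) = (A * B - smult c (X\<^sup>2 * U\<^sup>2))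
      + X * (B\<^sup>2 - smult c (X\<^sup>2 * U * W)) + - X * (B\<^sup>2 - A * V)"
    unfolding A V by (simp only: smult_diff_right smult_add_right power2_eq_square algebra_simps mult_smult_right mult_smult_left)
  ultimately show ?thesis by simp
qed

lemma pathQ'_rec:
  assumes "3 \<le> m"
  shows "pathQ' (Suc m) c = pathQ (Suc m) c + X * pathQ' m c - smult c (X\<^sup>2 * (- X) ^ m)"
proof -
  obtain n where m: "m = Suc (Suc (Suc n))"
    using assms by (auto dest: le_Suc_ex simp: numeral_3_eq_3)
  define A B W where "A = pathpoly (Suc m)" and "B = pathpoly m" and "W = pathpoly n"
  define U V where "U = pathpoly (Suc n)" and "V = pathpoly (Suc (Suc n))"
  have B: "B = V + X * U"
    by (simp_all add: B_def V_def U_def m)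
  have "(- X) ^ m = V\<^sup>2 - B * U"
    using cassini[of "Suc n"] by (simp add: m B_def V_def U_def)
  moreover have "pathQ (Suc m) c = A\<^sup>2 - smult c (X\<^sup>2 * V * U)"
    "pathQ' m c = A * B - smult c (X\<^sup>2 * U\<^sup>2)" "pathQ' (Suc m) c = (A + X * B) * A - smult c (X\<^sup>2 * V\<^sup>2)"
    by (simp_all add: pathQ_def pathQ'_def m A_def B_def U_def V_def W_def numeral_2_eq_2 numeral_3_eq_3)
  moreover have "(A + X * B) * A - smult c (X\<^sup>2 * V\<^sup>2) = (A\<^sup>2 - smult c (X\<^sup>2 * V * U))
      + X * (A * B - smult c (X\<^sup>2 * U\<^sup>2)) - smult c (X\<^sup>2 * (V\<^sup>2 - B * U))"
    unfolding B by (simp only: smult_diff_right smult_add_right power2_eq_square algebra_simps mult_smult_right mult_smult_left)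
  ultimately show ?thesis by simp
qed

lemma minus_X_power: "(- X) ^ k = monom ((- 1) ^ k) k"
proof -
  have "- X = monom (- 1) 1" by (simp add: minus_monom)
  then show ?thesis by (simp add: monom_power)
qed

lemma coeff_pathQ_rec:
  assumes "3 \<le> m"
  shows "coeff (pathQ (Suc m) c) i = coeff (pathQ' m c) i
    + (if i = 0 then 0 else coeff (pathQ m c) (i - 1)) + (if i = m + 2 then (- 1) ^ m else 0)"
  unfolding pathQ_rec[OF assms] minus_X_power
  by (simp add: coeff_monom_mult)

lemma coeff_pathQ'_rec:
  assumes "3 \<le> m"
  shows "coeff (pathQ' (Suc m) c) i = coeff (pathQ (Suc m) c) i
    + (if i = 0 then 0 else coeff (pathQ' m c) (i - 1)) - (if i = m + 2 then c * (- 1) ^ m else 0)"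
  unfolding pathQ'_rec[OF assms] minus_X_power
  by (simp add: coeff_monom_mult power2_eq_square mult_monom)

section \<open>Interlacing ratios along the path recurrence\<close>

text \<open>For positive entries:
  \<open>a (i + 1) / a i \<le> b i / b (i - 1) \<le> a i / a (i - 1)\<close>. It is used for
  \<open>i\<close> at least 1.\<close>

definition interl :: "(nat \<Rightarrow> real) \<Rightarrow> (nat \<Rightarrow> real) \<Rightarrow> nat \<Rightarrow> bool" where
  "interl b a i \<longleftrightarrow> b i * a (i - 1) \<le> b (i - 1) * a i \<and> a (i + 1) * b (i - 1) \<le> a i * b i"

lemma interl_lc:
  assumes "interl b a i" "0 < b (i - 1)" "0 \<le> a i" "0 \<le> a (i - 1)"
  shows "a (i + 1) * a (i - 1) \<le> a i * a i"
proof -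
  have "b (i - 1) * (a (i + 1) * a (i - 1)) = (a (i + 1) * b (i - 1)) * a (i - 1)"
    by (simp add: mult_ac)
  also have "\<dots> \<le> (a i * b i) * a (i - 1)"
    using assms by (intro mult_right_mono) (auto simp: interl_def)
  also have "\<dots> = a i * (b i * a (i - 1))" by (simp add: mult_ac)
  also have "\<dots> \<le> a i * (b (i - 1) * a i)"
    using assms by (intro mult_left_mono) (auto simp: interl_def)
  finally show ?thesis using assms(2) by (simp add: mult_ac)
qed

text \<open>Here \<open>d\<close> stands for \<open>a + x b\<close>; because of the Cassini terms, its coefficient \<open>i + 1\<close> is only
  assumed to be bounded above.\<close>

lemma interl_step:
  assumes e: "\<And>i. 1 \<le> i \<Longrightarrow> i \<le> n \<Longrightarrow> interl b a i"
    and n: "\<And>i. i \<le> n \<Longrightarrow> d i = a i + (if i = 0 then 0 else b (i - 1))"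
    and i: "1 \<le> i" "i \<le> n" and top: "d (i + 1) \<le> a (i + 1) + b i"
    and pos: "\<And>i. i \<le> n \<Longrightarrow> 0 \<le> a i" "\<And>i. i < n \<Longrightarrow> 0 < b i"
  shows "interl a d i"
  unfolding interl_def
proof
  show "a i * d (i - 1) \<le> a (i - 1) * d i"
  proof (cases "i = 1")
    case True
    then show ?thesis using i n[of 0] n[of 1] pos(1)[of 0] pos(2)[of 0]
      by (simp add: distrib_left mult.commute)
  next
    case False
    \<comment> \<open>The second half of interlacing at \<open>i - 1\<close>; the terms without
      \<open>b\<close> cancel in the goal.\<close>
    then have "a i * b (i - 2) \<le> a (i - 1) * b (i - 1)"
      using e[of "i - 1"] i by (simp add: interl_def numeral_2_eq_2)
    then show ?thesis using n[of "i - 1"] n[of i] i False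
      by (simp add: algebra_simps numeral_2_eq_2)
  qed
  have "a (i + 1) * a (i - 1) \<le> a i * a i" "b i * a (i - 1) \<le> b (i - 1) * a i"
    using i e[of i] pos interl_lc[of b a i] by (auto simp: interl_def)
  then have "(a (i + 1) + b i) * a (i - 1) \<le> d i * a i"
    using n[of i] i by (simp add: algebra_simps)
  moreover have "d (i + 1) * a (i - 1) \<le> (a (i + 1) + b i) * a (i - 1)"
    using top pos(1)[of "i - 1"] i by (intro mult_right_mono) auto
  ultimately show "d (i + 1) * a (i - 1) \<le> d i * a i" by linarith
qed

lemma interl_top:
  assumes e: "\<And>i. 1 \<le> i \<Longrightarrow> i \<le> n \<Longrightarrow> interl b a i" and "1 \<le> n"
    and n: "\<And>i. i \<le> n + 1 \<Longrightarrow> d i = a i + (if i = 0 then 0 else b (i - 1))"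
    and top: "d (n + 2) * a n \<le> d (n + 1) * a (n + 1)"
  shows "interl a d (n + 1)"
proof -
  have "a (n + 1) * b (n - 1) \<le> a n * b n"
    using e[of n] assms(2) by (simp add: interl_def)
  then show ?thesis
    using n[of n] n[of "n + 1"] top assms(2) by (simp add: interl_def algebra_simps)
qed

definition lpathP' :: "nat \<Rightarrow> int list" where "lpathP' k = lmul (lpath (Suc k)) (lpath k)"
definition lpathH' :: "nat \<Rightarrow> int list" where "lpathH' k = 0 # 0 # lmul (lpath (k - 2)) (lpath (k - 2))"

lemma pathQ'_lists: "pathQ' k c = ipol (lpathP' k) - smult c (ipol (lpathH' k))"
  by (simp add: pathQ'_def lpathP'_def lpathH'_def ipol_lmul ipol_lpath power2_eq_square monom_altdef)

definition pairs9 :: "(int \<times> int) list" where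
  "pairs9 = [(1, 0), (18, 0), (137, 1), (574, 13), (1444, 67), (2232, 174), (2083, 239),
     (1106, 166), (295, 50), (30, 4), (1, 0)]"
definition pairs9' :: "(int \<times> int) list" where
  "pairs9' = [(1, 0), (19, 0), (154, 1), (695, 14), (1912, 79), (3300, 230), (3544, 367),
     (2269, 314), (791, 130), (125, 20), (6, 1)]"

lemma pairs9: "pairs (lpathP 9) (lpathH 9) = pairs9" "pairs (lpathP' 9) (lpathH' 9) = pairs9'"
  "length (lpathH 9) \<le> length (lpathP 9)" "length (lpathH' 9) \<le> length (lpathP' 9)"
  by code_simp+

lemma coeff_pathQ_9:
  "coeff (pathQ 9 c) i = (if i < 11 then val c (pairs9 ! i) else 0)"
  "coeff (pathQ' 9 c) i = (if i < 11 then val c (pairs9' ! i) else 0)"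
proof -
  have "pathQ 9 c = Poly (map (val c) pairs9)" "pathQ' 9 c = Poly (map (val c) pairs9')"
    unfolding pathQ_lists pathQ'_lists pairs9(1,2)[symmetric] using Poly_pairs pairs9(3,4) by simp_all
  moreover have "length pairs9 = 11" "length pairs9' = 11"
    by (simp_all add: pairs9_def pairs9'_def)
  ultimately show "coeff (pathQ 9 c) i = (if i < 11 then val c (pairs9 ! i) else 0)"
    "coeff (pathQ' 9 c) i = (if i < 11 then val c (pairs9' ! i) else 0)"
    by (simp_all add: nth_default_def)
qed

text \<open>The base case of the induction, uniform in \<open>c\<close>.\<close>

lemma pairs9_interl:
  "\<forall>i \<in> set [1..<10]. bern_le (pairs9 ! i) (pairs9' ! (i - 1)) (pairs9 ! (i - 1)) (pairs9' ! i)
     \<and> bern_le (pairs9' ! (i + 1)) (pairs9 ! (i - 1)) (pairs9' ! i) (pairs9 ! i)"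
  "\<forall>i \<in> set [0..<11]. pos (pairs9 ! i) \<and> pos (pairs9' ! i)"
  by code_simp+

text \<open>For \<open>m = 2 * t\<close>, the coefficient of degree \<open>m - 1\<close> of \<open>pathQ m c\<close> is \<open>topP c t\<close>, and that of
  degree \<open>m\<close> of \<open>pathQ' m c\<close> is \<open>topG c t\<close>. The Cassini terms enter the recurrences in this range.\<close>

definition topG :: "real \<Rightarrow> real \<Rightarrow> real" where
  "topG c t = (t + 2) * (t + 1)\<^sup>2 / 2 + (t + 2) * (t + 1) * t / 6 - c * t\<^sup>2"

definition topP :: "real \<Rightarrow> real \<Rightarrow> real" where
  "topP c t = (t + 1)\<^sup>2 * (t + 2) * t / 3 - c * (t\<^sup>2 * (t - 1) / 2 + (t + 1) * t * (t - 1) / 6)"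

text \<open>These are the top conditions for \<open>interl_top\<close>. In the variables
  \<open>t - 5\<close> and \<open>4 - c\<close>, both nonnegative, the differences have nonnegative
  coefficients only.\<close>

lemma top_ineqs:
  assumes "5 \<le> t" "c \<le> 4"
  shows "topG c t \<le> ((t + 2) * (t + 1) - c * t) * (t + 1)"
    "(t + 1) * topP c t \<le> topG c t * ((t + 1)\<^sup>2 - c * t)"
proof -
  define p u where "p = t - 5" and "u = 4 - c"
  have t: "t = p + 5" "c = 4 - u" and nn: "0 \<le> p" "0 \<le> u"
    using assms by (auto simp: p_def u_def)
  have "6 * (((t + 2) * (t + 1) - c * t) * (t + 1) - topG c t)
      = 2 * p ^ 3 + 39 * p ^ 2 + 229 * p + 426 + 6 * (p * u) + 30 * u"
    unfolding topG_def t by (simp add: power2_eq_square power3_eq_cube field_simps)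
  also have "\<dots> \<ge> 0" using nn by simp
  finally show "topG c t \<le> ((t + 2) * (t + 1) - c * t) * (t + 1)" by simp
  have "6 * (topG c t * ((t + 1)\<^sup>2 - c * t) - (t + 1) * topP c t)
      = 2 * p ^ 5 + 39 * p ^ 4 + 305 * p ^ 3 + 6 * (p ^ 4 * u) + 98 * (p ^ 3 * u) + 1158 * p ^ 2
        + 597 * (p ^ 2 * u) + 1952 * p + 1627 * (p * u) + 816 + 1710 * u + 6 * (p ^ 3 * u ^ 2)
        + 90 * (p ^ 2 * u ^ 2) + 450 * (p * u ^ 2) + 750 * u ^ 2"
    unfolding topG_def topP_def t by (simp add: eval_nat_numeral field_simps)
  also have "\<dots> \<ge> 0" using nn by simp
  finally show "(t + 1) * topP c t \<le> topG c t * ((t + 1)\<^sup>2 - c * t)" by simp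
qed

lemma coeff_path_zero:
  assumes "9 \<le> m"
  shows "m + 1 < i \<Longrightarrow> coeff (pathQ m c) i = 0" "m + 1 < i \<Longrightarrow> coeff (pathQ' m c) i = 0"
  using assms
proof (induction m arbitrary: i rule: dec_induct)
  case base
  {
    case 1 then show ?case by (simp add: coeff_pathQ_9)
  next
    case 2 then show ?case by (simp add: coeff_pathQ_9)
  }
next
  case (step n)
  have n: "3 \<le> n" using step by simp
  have q: "coeff (pathQ (Suc n) c) i = 0" if "Suc n + 1 < i" for i
    using step.IH[of i] step.IH[of "i - 1"] that unfolding coeff_pathQ_rec[OF n] by simp
  {
    case 1 then show ?case by (rule q)
  next
    case 2 then show ?case
      using step.IH[of i] step.IH[of "i - 1"] q unfolding coeff_pathQ'_rec[OF n] by simp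
  }
qed

text \<open>Each parity follows from the other by one use of the recurrences, starting from the
  explicit case 9. The signs of the Cassini terms alternate, so the coefficient of degree
  \<open>m + 1\<close> of \<open>pathQ m\<close> is 1 for odd and 0 for even
  \<open>m\<close>.\<close>

lemma path_top:
  assumes "4 \<le> t"
  shows "coeff (pathQ (2 * t + 1) c) (2 * t + 2) = 1
    \<and> coeff (pathQ (2 * t + 1) c) (2 * t + 1) = (real t + 2) * (real t + 1) - c * real t
    \<and> coeff (pathQ (2 * t + 1) c) (2 * t) = topG c t + topP c t
    \<and> coeff (pathQ' (2 * t + 1) c) (2 * t + 2) = real t + 2 - c
    \<and> coeff (pathQ' (2 * t + 1) c) (2 * t + 1) = (real t + 2) * (real t + 1) - c * real t + topG c t"
    (is "?odd t")
    and "coeff (pathQ (2 * t + 2) c) (2 * t + 3) = 0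
    \<and> coeff (pathQ (2 * t + 2) c) (2 * t + 2) = (real t + 2)\<^sup>2 - c * (real t + 1)
    \<and> coeff (pathQ (2 * t + 2) c) (2 * t + 1) = topP c (real t + 1)
    \<and> coeff (pathQ' (2 * t + 2) c) (2 * t + 3) = real t + 2
    \<and> coeff (pathQ' (2 * t + 2) c) (2 * t + 2) = topG c (real t + 1)"
    (is "?even t")
proof -
  have nn: "x + 3 = Suc (Suc (Suc x))" "x + 4 = Suc (Suc (Suc (Suc x)))" for x :: nat
    by simp_all
  have even: "?even t" if o: "?odd t" and t: "4 \<le> t" for t
  proof -
    have m: "3 \<le> 2 * t + 1" "9 \<le> 2 * t + 1" using t by auto
    have z: "coeff (pathQ' (2 * t + 1) c) (2 * t + 3) = 0"
      using coeff_path_zero(2)[OF m(2)] by simp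
    note r = coeff_pathQ_rec[OF m(1), of c] and r' = coeff_pathQ'_rec[OF m(1), of c]
    have rs: "coeff (pathQ (2 * t + 2) c) (2 * t + 3)
        = coeff (pathQ' (2 * t + 1) c) (2 * t + 3) + coeff (pathQ (2 * t + 1) c) (2 * t + 2) - 1"
      "coeff (pathQ (2 * t + 2) c) (2 * t + 2)
        = coeff (pathQ' (2 * t + 1) c) (2 * t + 2) + coeff (pathQ (2 * t + 1) c) (2 * t + 1)"
      "coeff (pathQ (2 * t + 2) c) (2 * t + 1)
        = coeff (pathQ' (2 * t + 1) c) (2 * t + 1) + coeff (pathQ (2 * t + 1) c) (2 * t)"
      "coeff (pathQ' (2 * t + 2) c) (2 * t + 3)
        = coeff (pathQ (2 * t + 2) c) (2 * t + 3) + coeff (pathQ' (2 * t + 1) c) (2 * t + 2) + c"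
      "coeff (pathQ' (2 * t + 2) c) (2 * t + 2)
        = coeff (pathQ (2 * t + 2) c) (2 * t + 2) + coeff (pathQ' (2 * t + 1) c) (2 * t + 1)"
      using r[of "2 * t + 3"] r[of "2 * t + 2"] r[of "2 * t + 1"] r'[of "2 * t + 3"] r'[of "2 * t + 2"]
      by (simp_all add: nn)
    show ?thesis
      unfolding rs z using o by (simp add: topG_def topP_def power2_eq_square field_simps)
  qed
  have odd: "?odd t" if "4 \<le> t" for t
    using that
  proof (induction t rule: dec_induct)
    case base
    show ?case
      by (simp add: coeff_pathQ_9 pairs9_def pairs9'_def topG_def topP_def)
  next
    case (step n)
    note e = even[OF step.IH step(1)]
    have m: "3 \<le> 2 * n + 2" "9 \<le> 2 * n + 2" using step(1) by auto
    have z: "coeff (pathQ' (2 * n + 2) c) (2 * n + 4) = 0"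
      using coeff_path_zero(2)[OF m(2)] by simp
    note r = coeff_pathQ_rec[OF m(1), of c] and r' = coeff_pathQ'_rec[OF m(1), of c]
    have s: "2 * Suc n + 1 = 2 * n + 3" "2 * Suc n + 2 = 2 * n + 4" "2 * Suc n = 2 * n + 2" by simp_all
    have rs: "coeff (pathQ (2 * n + 3) c) (2 * n + 4)
        = coeff (pathQ' (2 * n + 2) c) (2 * n + 4) + coeff (pathQ (2 * n + 2) c) (2 * n + 3) + 1"
      "coeff (pathQ (2 * n + 3) c) (2 * n + 3)
        = coeff (pathQ' (2 * n + 2) c) (2 * n + 3) + coeff (pathQ (2 * n + 2) c) (2 * n + 2)"
      "coeff (pathQ (2 * n + 3) c) (2 * n + 2)
        = coeff (pathQ' (2 * n + 2) c) (2 * n + 2) + coeff (pathQ (2 * n + 2) c) (2 * n + 1)"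
      "coeff (pathQ' (2 * n + 3) c) (2 * n + 4)
        = coeff (pathQ (2 * n + 3) c) (2 * n + 4) + coeff (pathQ' (2 * n + 2) c) (2 * n + 3) - c"
      "coeff (pathQ' (2 * n + 3) c) (2 * n + 3)
        = coeff (pathQ (2 * n + 3) c) (2 * n + 3) + coeff (pathQ' (2 * n + 2) c) (2 * n + 2)"
      using r[of "2 * n + 4"] r[of "2 * n + 3"] r[of "2 * n + 2"] r'[of "2 * n + 4"] r'[of "2 * n + 3"]
      by (simp_all add: nn)
    show ?case
      unfolding s(1,2) unfolding s(3) rs z using e by (simp add: power2_eq_square algebra_simps)
  qed
  show "?odd t" "?even t"
    using odd even assms by blast+
qed

text \<open>Positivity of \<open>pathQ m\<close> stops at \<open>m\<close>, since its next
  coefficient vanishes for even \<open>m\<close>.\<close>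

definition path_inv :: "real \<Rightarrow> nat \<Rightarrow> bool" where
  "path_inv c m \<longleftrightarrow> (\<forall>i\<le>m. 0 < coeff (pathQ m c) i) \<and> (\<forall>i\<le>m + 1. 0 < coeff (pathQ' m c) i)
     \<and> (\<forall>i. 1 \<le> i \<longrightarrow> i \<le> m \<longrightarrow> interl (coeff (pathQ m c)) (coeff (pathQ' m c)) i)"

lemma path_inv_9:
  assumes "0 \<le> c" "c \<le> 4"
  shows "path_inv c 9"
proof -
  have m: "i \<in> set [0..<11]" if "i \<le> 10" for i using that unfolding set_upt by simp
  have m': "i \<in> set [1..<10]" if "1 \<le> i" "i \<le> 9" for i using that unfolding set_upt by simp
  show ?thesis
    unfolding path_inv_def interl_def coeff_pathQ_9
    using pairs9_interl m m' pos[OF _ assms] bern_le[OF _ assms] by auto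
qed

text \<open>Interlacing passes along the chain \<open>b\<close>, \<open>a\<close>, \<open>d\<close>,
  \<open>e\<close>. Away from the top this is \<open>interl_step\<close>; at the top the parity of
  \<open>m\<close> decides whether a Cassini term is harmless or \<open>path_top\<close> and
  \<open>top_ineqs\<close> are needed.\<close>

lemma path_inv_step:
  assumes c: "0 \<le> c" "c \<le> 4" and m: "9 \<le> m" and inv: "path_inv c m"
  shows "path_inv c (Suc m)"
    and "1 \<le> i \<Longrightarrow> i \<le> m + 1 \<Longrightarrow> interl (coeff (pathQ' m c)) (coeff (pathQ (Suc m) c)) i"
proof -
  define b a d e where "b = coeff (pathQ m c)" and "a = coeff (pathQ' m c)"
    and "d = coeff (pathQ (Suc m) c)" and "e = coeff (pathQ' (Suc m) c)"
  note defs = b_def a_def d_def e_def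
  have m3: "3 \<le> m" using m by simp
  have bpos: "0 < b i" if "i \<le> m" for i using inv that by (simp add: path_inv_def defs)
  have apos: "0 < a i" if "i \<le> m + 1" for i using inv that by (simp add: path_inv_def defs)
  have ba: "interl b a i" if "1 \<le> i" "i \<le> m" for i using inv that by (simp add: path_inv_def defs)
  have d: "d i = a i + (if i = 0 then 0 else b (i - 1))" if "i \<le> m + 1" for i
    using that coeff_pathQ_rec[OF m3, of c i] by (simp add: defs)
  have dtop: "d (m + 2) = a (m + 2) + b (m + 1) + (- 1) ^ m"
    using coeff_pathQ_rec[OF m3, of c "m + 2"] by (simp add: defs)
  have e: "e i = d i + (if i = 0 then 0 else a (i - 1))" if "i \<le> m + 1" for i
    using that coeff_pathQ'_rec[OF m3, of c i] by (simp add: defs)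
  have etop: "e (m + 2) = d (m + 2) + a (m + 1) - c * (- 1) ^ m"
    using coeff_pathQ'_rec[OF m3, of c "m + 2"] by (simp add: defs)
  have dpos: "0 < d i" if "i \<le> m + 1" for i
  proof (cases i)
    case (Suc k)
    then show ?thesis using d[OF that] apos[OF that] bpos[of k] that by simp
  qed (use d[of 0] apos[of 0] in simp)
  have epos: "0 < e i" if "i \<le> m + 1" for i
  proof (cases i)
    case (Suc k)
    then show ?thesis using e[OF that] dpos[OF that] apos[of k] that by simp
  qed (use e[of 0] dpos[of 0] in simp)
  obtain t where t: "m = 2 * t + 1 \<or> m = 2 * t + 2" "4 \<le> t"
  proof -
    have "m = 2 * ((m - 1) div 2) + 1 \<or> m = 2 * ((m - 1) div 2) + 2" "4 \<le> (m - 1) div 2"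
      using m by presburger+
    then show ?thesis by (rule that)
  qed
  have ad: "interl a d i" if i: "1 \<le> i" "i \<le> m + 1" for i
  proof (cases "i \<le> m")
    case True
    show ?thesis
    proof (rule interl_step[of m b])
      show "d (i + 1) \<le> a (i + 1) + b i" using d[of "i + 1"] True by simp
    qed (use ba d apos bpos True i in \<open>auto intro: less_imp_le\<close>)
  next
    case False
    then have im: "i = m + 1" using i by simp
    show ?thesis
      unfolding im
    proof (rule interl_top[OF ba])
      show "d (m + 2) * a m \<le> d (m + 1) * a (m + 1)"
        using t(1)
      proof
        assume mt: "m = 2 * t + 1"
        \<comment> \<open>For odd \<open>m\<close> the Cassini term cancels the leading
          coefficient.\<close>
        have "d (m + 2) = 0"
          using path_top(2)[OF t(2), of c] by (simp add: d_def mt eval_nat_numeral)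
        then show ?thesis using dpos[of "m + 1"] apos[of "m + 1"] by simp
      next
        assume mt: "m = 2 * t + 2"
        have "4 \<le> t + 1" using t(2) by simp
        note o = path_top(1)[OF this, of c] and ev = path_top(2)[OF t(2), of c]
        have "d (m + 2) = 1" "d (m + 1) = (real t + 3) * (real t + 2) - c * (real t + 1)"
          "a m = topG c (real t + 1)" "a (m + 1) = real t + 2"
          using o ev by (auto simp: d_def a_def mt eval_nat_numeral algebra_simps)
        then show ?thesis
          using top_ineqs(1)[of "real t + 1" c] t(2) c by (simp add: add.commute)
      qed
    qed (use d m in auto)
  qed
  have de: "interl d e i" if i: "1 \<le> i" "i \<le> m + 1" for i
  \<comment> \<open>For even \<open>m\<close> the term \<open>- c * (- 1) ^ m\<close> only lowers
    \<open>e (m + 2)\<close>, so \<open>interl_step\<close> reaches index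
    \<open>m + 1\<close>.\<close>
  proof (cases "i \<le> m \<or> m = 2 * t + 2")
    case True
    show ?thesis
    proof (rule interl_step[of "m + 1" a])
      show "e (i + 1) \<le> d (i + 1) + a i"
      proof (cases "i \<le> m")
        case True
        then show ?thesis using e[of "i + 1"] by simp
      next
        case False
        then have "i = m + 1" "even m" using i True by auto
        then show ?thesis using etop c by simp
      qed
    qed (use ad e dpos apos i in \<open>auto intro: less_imp_le\<close>)
  next
    case False
    then have im: "i = m + 1" and mt: "m = 2 * t + 1" using i t(1) by auto
    show ?thesis
      unfolding im
    proof (rule interl_top[of m a])
      note ev = path_top(2)[OF t(2), of c]
      have "e (m + 2) = real t + 2" "e (m + 1) = topG c (real t + 1)"
        "d m = topP c (real t + 1)" "d (m + 1) = (real t + 2)\<^sup>2 - c * (real t + 1)"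
        using ev by (auto simp: d_def e_def mt eval_nat_numeral)
      then show "e (m + 2) * d m \<le> e (m + 1) * d (m + 1)"
        using top_ineqs(2)[of "real t + 1" c] t(2) c by (simp add: add.commute)
    qed (use ad e m in auto)
  qed
  have "0 < e (m + 2)"
    using t(1)
  proof
    assume mt: "m = 2 * t + 1"
    then show ?thesis
      using path_top(2)[OF t(2), of c] by (simp add: e_def eval_nat_numeral)
  next
    assume mt: "m = 2 * t + 2"
    have "4 \<le> t + 1" using t(2) by simp
    then show ?thesis
      using path_top(1)[of "t + 1" c] t(2) c by (simp add: e_def mt eval_nat_numeral)
  qed
  then have "0 < e i" if "i \<le> m + 2" for i
    using epos[of i] that by (cases "i \<le> m + 1") (auto simp: le_Suc_eq)
  then show "path_inv c (Suc m)"
    using dpos de unfolding path_inv_def defs by simp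
  show "interl (coeff (pathQ' m c)) (coeff (pathQ (Suc m) c)) i" if "1 \<le> i" "i \<le> m + 1"
    using ad that by (simp add: defs)
qed

lemma path_inv:
  assumes "0 \<le> c" "c \<le> 4" "9 \<le> m"
  shows "path_inv c m"
  using assms(3)
  by (induction m rule: dec_induct) (use assms path_inv_9 path_inv_step in auto)

text \<open>\<open>pathQ k\<close> is the second member of the interlacing pair starting with
  \<open>pathQ' (k - 1)\<close>, so \<open>interl_lc\<close> gives every adjacent
  inequality.\<close>

lemma logc_pathQ_large:
  assumes c: "0 \<le> c" "c \<le> 4" and "10 \<le> k"
  shows "logc (pathQ k c)"
proof -
  obtain m where k: "k = Suc m" and m: "9 \<le> m" using assms(3) by (cases k) auto
  note inv = path_inv[OF c m] and step = path_inv_step[OF c m path_inv[OF c m]]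
  have pos: "0 < coeff (pathQ k c) i" if "i \<le> k" for i
    using step(1) that by (simp add: k path_inv_def)
  show ?thesis
  proof (rule logcI[where n = "k + 1"])
    show "coeff (pathQ k c) i = 0" if "k + 1 < i" for i
      using coeff_path_zero(1)[of k] that assms by simp
    show "0 < coeff (pathQ k c) i" if "i < k + 1" for i
      using pos that by simp
    show "0 \<le> coeff (pathQ k c) (k + 1)"
    proof -
      have "k = 2 * ((k - 1) div 2) + 1 \<or> k = 2 * ((k - 1) div 2) + 2" "4 \<le> (k - 1) div 2"
        using assms(3) by presburger+
      then show ?thesis
        using path_top[of "(k - 1) div 2" c] by (auto simp: eval_nat_numeral)
    qed
    show "coeff (pathQ k c) i * coeff (pathQ k c) (i + 2) \<le> (coeff (pathQ k c) (i + 1))\<^sup>2" if "i + 2 \<le> k + 1" for i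
    proof -
      have "interl (coeff (pathQ' m c)) (coeff (pathQ k c)) (i + 1)"
        using step(2)[of "i + 1"] that by (simp add: k)
      moreover have "0 < coeff (pathQ' m c) i"
        using inv that by (simp add: path_inv_def k)
      ultimately show ?thesis
        using interl_lc[of "coeff (pathQ' m c)" "coeff (pathQ k c)" "i + 1"] pos[of i] pos[of "i + 1"] that
        by (simp add: power2_eq_square mult.commute)
    qed
  qed
qed

section \<open>The exceptional paths on three and five vertices\<close>

lemma pathQ_3: "pathQ 3 c = Poly [1, 6, 11 - c, 6 - c, 1]"
proof -
  have "lpathP 3 = [1, 6, 11, 6, 1]" "lpathH 3 = [0, 0, 1, 1]"
    by code_simp+
  then show ?thesis unfolding pathQ_lists by simp
qed

text \<open>The critical inequality is the last one, (6-c)^2 against 11-c; it holds for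
  \<open>c\<close> up to 3 and fails at 4.\<close>

lemma logc_pathQ_3:
  assumes "0 \<le> c" "c \<le> 3"
  shows "logc (pathQ 3 c)"
proof -
  define u where "u = 3 - c"
  have u: "0 \<le> u" "u \<le> 3" "c = 3 - u" using assms by (auto simp: u_def)
  then show ?thesis
    unfolding pathQ_3 u(3) by (intro logc_Poly) (simp add: algebra_simps)
qed

text \<open>With \<open>u = 4 - c\<close> and \<open>s = 1 - d\<close> between 0 and 1, the products
  of their powers are named as new variables. Every condition then is linear, and its few negative
  terms are outweighed by the constant.\<close>

lemma logc_pathQ_3_pair:
  assumes "3 \<le> c" "c \<le> 4" "0 \<le> d" "d \<le> 1"
  shows "logc (pathQ 3 c * pathQ 3 d)"
proof -
  define u s where "u = 4 - c" and "s = 1 - d"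
  have b: "0 \<le> u" "u \<le> 1" "0 \<le> s" "s \<le> 1" "c = 4 - u" "d = 1 - s"
    using assms by (auto simp: u_def s_def)
  define m11 m20 m02 m12 m21 m22 where m: "m11 = u * s" "m20 = u * u" "m02 = s * s"
    "m12 = u * (s * s)" "m21 = (u * u) * s" "m22 = (u * u) * (s * s)"
  have nn: "0 \<le> m11" "0 \<le> m20" "0 \<le> m02" "0 \<le> m12" "0 \<le> m21" "0 \<le> m22" "m12 \<le> 1" "m21 \<le> 1"
    using b by (auto simp: m intro!: mult_le_one)
  define e0 e1 e2 e3 e4 e5 e6 e7 e8 :: real where e: "e0 = 1" "e1 = 12" "e2 = 53 + s + u" "e3 = 109 + 7 * s +
    7 * u" "e4 = 114 + 13 * s + 16 * u + m11" "e5 = 67 + 9 * s + 15 * u + 2 * m11" "e6 = 27 + 3 * s + 6 * u +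
    m11" "e7 = 7 + s + u" "e8 = 1"
  have prod: "pathQ 3 c * pathQ 3 d = Poly [e0, e1, e2, e3, e4, e5, e6, e7, e8]"
    unfolding pathQ_3 b(5,6) by (simp add: e m algebra_simps)
  have "e1 * e1 - e0 * e2 = 91 - s - u"
    by (simp add: e m algebra_simps)
  then have l1: "e0 * e2 \<le> e1 * e1" using b nn by linarith
  have "e2 * e2 - e1 * e3 = 1501 + 22 * s + m02 + 22 * u + 2 * m11 + m20"
    by (simp add: e m algebra_simps)
  then have l2: "e1 * e3 \<le> e2 * e2" using b nn by linarith
  have "e3 * e3 - e2 * e4 = 5839 + 723 * s + 36 * m02 + 564 * u + 16 * m11 - m12 + 33 * m20 - m21"
    by (simp add: e m algebra_simps)
  then have l3: "e2 * e4 \<le> e3 * e3" using b nn by linarith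
  have "e4 * e4 - e3 * e5 = 5693 + 1514 * s + 106 * m02 + 1544 * u + 258 * m11 + 12 * m12 + 151 * m20 + 18 * m21 + m22"
    by (simp add: e m algebra_simps)
  then have l4: "e3 * e5 \<le> e4 * e4" using b nn by linarith
  have "e5 * e5 - e4 * e6 = 1411 + 513 * s + 42 * m02 + 894 * u + 271 * m11 + 20 * m12 + 129 * m20 + 38 * m21 + 3 * m22"
    by (simp add: e m algebra_simps)
  then have l5: "e4 * e6 \<le> e5 * e5" using b nn by linarith
  have "e6 * e6 - e5 * e7 = 260 + 32 * s + 152 * u + 52 * m11 + 4 * m12 + 21 * m20 + 10 * m21 + m22"
    by (simp add: e m algebra_simps)
  then have l6: "e5 * e7 \<le> e6 * e6" using b nn by linarith
  have "e7 * e7 - e6 * e8 = 22 + 11 * s + m02 + 8 * u + m11 + m20"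
    by (simp add: e m algebra_simps)
  then have l7: "e6 * e8 \<le> e7 * e7" using b nn by linarith
  have p: "0 < e0" "0 < e1" "0 < e2" "0 < e3" "0 < e4" "0 < e5" "0 < e6" "0 < e7" "0 < e8"
    using b nn by (simp_all add: e add_pos_nonneg)
  show ?thesis
    unfolding prod by (rule logc_Poly) (use p l1 l2 l3 l4 l5 l6 l7 in simp)
qed

lemma pathQ_5: "pathQ 5 c = Poly [1, 10, 37 - c, 62 - 5 * c, 46 - 7 * c, 12 - 2 * c, 1]"
proof -
  have "lpathP 5 = [1, 10, 37, 62, 46, 12, 1]" "lpathH 5 = [0, 0, 1, 5, 7, 2]"
    by code_simp+
  then show ?thesis unfolding pathQ_lists by simp
qed

lemma logc_pathQ_5:
  assumes "0 \<le> c" "c \<le> 3"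
  shows "logc (pathQ 5 c)"
proof -
  define u where "u = 3 - c"
  have u: "0 \<le> u" "u \<le> 3" "c = 3 - u" using assms by (auto simp: u_def)
  then show ?thesis
    unfolding pathQ_5 u(3) by (intro logc_Poly) (simp add: algebra_simps)
qed

text \<open>The same linearization in products of powers of \<open>u\<close> and \<open>s\<close>;
  again the constants outweigh the few negative terms.\<close>

lemma logc_pathQ_5_pair:
  assumes "3 \<le> c" "c \<le> 4" "0 \<le> d" "d \<le> 1"
  shows "logc (pathQ 5 c * pathQ 5 d)"
proof -
  define u s where "u = 4 - c" and "s = 1 - d"
  have b: "0 \<le> u" "u \<le> 1" "0 \<le> s" "s \<le> 1" "c = 4 - u" "d = 1 - s"
    using assms by (auto simp: u_def s_def)
  define m11 m20 m02 m12 m21 m22 where m: "m11 = u * s" "m20 = u * u" "m02 = s * s"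
    "m12 = u * (s * s)" "m21 = (u * u) * s" "m22 = (u * u) * (s * s)"
  have nn: "0 \<le> m11" "0 \<le> m20" "0 \<le> m02" "0 \<le> m12" "0 \<le> m21" "0 \<le> m22" "m12 \<le> 1" "m21 \<le> 1"
    using b by (auto simp: m intro!: mult_le_one)
  define e0 e1 e2 e3 e4 e5 e6 e7 e8 e9 e10 e11 e12 :: real where e: "e0 = 1" "e1 = 20" "e2 = 169 + s + u" "e3
    = 789 + 15 * s + 15 * u" "e4 = 2235 + 90 * s + 93 * u + m11" "e5 = 3977 + 279 * s + 309 * u + 10 * m11"
    "e6 = 4471 + 479 * s + 596 * u + 39 * m11" "e7 = 3158 + 454 * s + 676 * u + 74 * m11" "e8 = 1419 + 231 * s
    + 438 * u + 69 * m11" "e9 = 435 + 69 * s + 153 * u + 28 * m11" "e10 = 97 + 15 * s + 27 * u + 4 * m11" "e11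
    = 14 + 2 * s + 2 * u" "e12 = 1"
  have prod: "pathQ 5 c * pathQ 5 d = Poly [e0, e1, e2, e3, e4, e5, e6, e7, e8, e9, e10, e11, e12]"
    unfolding pathQ_5 b(5,6) by (simp add: e m algebra_simps)
  have "e1 * e1 - e0 * e2 = 231 - s - u"
    by (simp add: e m algebra_simps)
  then have l1: "e0 * e2 \<le> e1 * e1" using b nn by linarith
  have "e2 * e2 - e1 * e3 = 12781 + 38 * s + m02 + 38 * u + 2 * m11 + m20"
    by (simp add: e m algebra_simps)
  then have l2: "e1 * e3 \<le> e2 * e2" using b nn by linarith
  have "e3 * e3 - e2 * e4 = 244806 + 6225 * s + 135 * m02 + 5718 * u + 98 * m11 - m12 + 132 * m20 - m21"
    by (simp add: e m algebra_simps)
  then have l3: "e2 * e4 \<le> e3 * e3" using b nn by linarith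
  have "e4 * e4 - e3 * e5 = 1857372 + 122514 * s + 3915 * m02 + 112254 * u + 4500 * m11 + 30 * m12 + 4014 * m20 + 36 * m21 + m22"
    by (simp add: e m algebra_simps)
  then have l4: "e3 * e5 \<le> e4 * e4" using b nn by linarith
  have "e5 * e5 - e4 * e6 = 5823844 + 746211 * s + 34731 * m02 + 709923 * u + 62139 * m11 + 1591 * m12 + 40053
      * m20 + 1957 * m21 + 61 * m22"
    by (simp add: e m algebra_simps)
  then have l5: "e4 * e6 \<le> e5 * e5" using b nn by linarith
  have "e6 * e6 - e5 * e7 = 7430475 + 1596578 * s + 102775 * m02 + 1665158 * u + 264938 * m11 + 12176 * m12 +
      146332 * m20 + 16862 * m21 + 781 * m22"
    by (simp add: e m algebra_simps)
  then have l6: "e5 * e7 \<le> e6 * e6" using b nn by linarith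
  have "e7 * e7 - e6 * e8 = 3628615 + 1154962 * s + 95467 * m02 + 1465594 * u + 369874 * m11 + 25132 * m12 +
      195928 * m20 + 41842 * m21 + 2785 * m22"
    by (simp add: e m algebra_simps)
  then have l7: "e6 * e8 \<le> e7 * e7" using b nn by linarith
  have "e8 * e8 - e7 * e9 = 639831 + 240186 * s + 22035 * m02 + 465810 * u + 161458 * m11 + 14060 * m12 +
      88416 * m20 + 30194 * m21 + 2689 * m22"
    by (simp add: e m algebra_simps)
  then have l8: "e7 * e9 \<le> e8 * e8" using b nn by linarith
  have "e9 * e9 - e8 * e10 = 51582 + 16338 * s + 1296 * m02 + 52311 * u + 20298 * m11 + 1905 * m12 + 11583 *
      m20 + 4953 * m21 + 508 * m22"
    by (simp add: e m algebra_simps)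
  then have l9: "e8 * e10 \<le> e9 * e9" using b nn by linarith
  have "e10 * e10 - e9 * e11 = 3319 + 1074 * s + 87 * m02 + 2226 * u + 750 * m11 + 64 * m12 + 423 * m20 + 160 * m21 + 16 * m22"
    by (simp add: e m algebra_simps)
  then have l10: "e9 * e11 \<le> e10 * e10" using b nn by linarith
  have "e11 * e11 - e10 * e12 = 99 + 41 * s + 4 * m02 + 29 * u + 4 * m11 + 4 * m20"
    by (simp add: e m algebra_simps)
  then have l11: "e10 * e12 \<le> e11 * e11" using b nn by linarith
  have p: "0 < e0" "0 < e1" "0 < e2" "0 < e3" "0 < e4" "0 < e5" "0 < e6" "0 < e7" "0 < e8" "0 < e9" "0 < e10" "0 < e11" "0 < e12"
    using b nn by (simp_all add: e add_pos_nonneg)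
  show ?thesis
    unfolding prod by (rule logc_Poly) (use p l1 l2 l3 l4 l5 l6 l7 l8 l9 l10 l11 in simp)
qed

section \<open>Log-concavity of the independence polynomials themselves\<close>

text \<open>The Fibonacci recurrence is itself a continuant with \<open>g = 1\<close> and
  \<open>h = - X\<close>, so the polynomial splits into factors 1 + c x with \<open>c\<close>
  nonnegative. Prefixing one more 1 supplies the required initial values; positivity of
  \<open>h\<close> is used at negative points.\<close>

lemma logc_pathpoly: "logc (pathpoly k)"
proof -
  define p where "p n = (case n of 0 \<Rightarrow> 1 | Suc m \<Rightarrow> pathpoly m)" for n
  have rec: "p (Suc (Suc n)) = 1 * p (Suc n) - (- X) * p n" for n
    by (cases n) (simp_all add: p_def monom_altdef one_pCons)
  have "poly (- X) x = - x" for x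
    by (simp add: monom_altdef)
  then have "{..<0} \<subseteq> {x. 0 < poly (- X) x}" by auto
  then have inf: "infinite {x. 0 < poly (- X) x}"
    using infinite_Iio[of "0::real"] infinite_super by blast
  have "p (Suc k) = (\<Prod>j\<in>{1..Suc k div 2}. 1\<^sup>2 - smult ((2 * cos (ang (Suc k) j))\<^sup>2) (- X)) * (if odd (Suc k) then 1 else 1)"
    by (rule continuant_factorization[where p = p and g = 1 and h = "- X"])
      (rule rec inf | simp add: p_def)+
  moreover have "logc (1\<^sup>2 - smult c (- X))" if "0 \<le> c" for c
  proof -
    have "1\<^sup>2 - smult c (- X) = Poly [1, c]"
      unfolding power_one by (simp add: monom_altdef one_pCons)
    then show ?thesis using logc_Poly[of "[1, c]"] that by simp
  qed
  ultimately have "logc (p (Suc k))"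
    by (auto intro!: logc_prod)
  then show ?thesis by (simp add: p_def)
qed

text \<open>Adding \<open>X\<close> can only hurt where coefficient 1 is an outer term. There
  ultra-log-concavity gives a factor 2/3, and \<open>coeff M 1\<close> is at least 2 unless
  \<open>L = 0\<close>, so raising it by 1 costs at most a factor 3/2.\<close>

lemma logc_star_linear:
  assumes "d \<le> L"
  shows "logc (X1 ^ d * (X1 ^ (L - d) + X) + X)"
proof -
  define M where "M = X1 ^ d * (X1 ^ (L - d) + X)"
  have ul: "ulogc M"
    unfolding M_def by (intro ulogc_mult ulogc_power ulogc_X1 ulogc_X1_power_add)
  have "M = X1 ^ L + X * X1 ^ d"
    using assms by (simp only: M_def distrib_left power_add[symmetric] le_add_diff_inverse mult.commute)
  then have cM: "coeff M i = real (L choose i) + (if i = 0 then 0 else real (d choose (i - 1)))" for i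
    by (simp add: coeff_X1_power coeff_monom_mult)
  have c: "coeff (M + X) i = coeff M i + (if i = 1 then 1 else 0)" for i
    by simp
  have nn: "0 \<le> coeff M i" for i
    by (simp add: cM)
  have adj: "coeff M i * coeff M (i + 2) \<le> (coeff M (i + 1))\<^sup>2" for i
    using ul logcD[of M i 1 1] by (simp add: ulogc_def power2_eq_square)
  show ?thesis
    unfolding M_def[symmetric]
  proof (rule logcI[where n = "max L (d + 1)"])
    have pos: "0 < coeff (M + X) i" if "i \<le> max L (d + 1)" for i
    proof (cases "i \<le> L")
      case True
      then have "0 < coeff M i" unfolding cM by (intro add_pos_nonneg) auto
      then show ?thesis unfolding c by (auto intro: add_pos_pos)
    next
      case False
      then have "i = d + 1" using that assms by auto
      then show ?thesis unfolding c using nn by (simp add: cM add_nonneg_pos)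
    qed
    then show "0 < coeff (M + X) i" if "i < max L (d + 1)" for i
      using that by simp
    show "0 \<le> coeff (M + X) (max L (d + 1))"
      using pos[OF order_refl] by simp
    show "coeff (M + X) i = 0" if "max L (d + 1) < i" for i
      using that unfolding c cM by (auto simp: binomial_eq_0)
    fix i
    show "coeff (M + X) i * coeff (M + X) (i + 2) \<le> (coeff (M + X) (i + 1))\<^sup>2"
    proof (cases "i = 1")
      case True
      have "3 * (coeff M 1 * coeff M 3) \<le> 2 * (coeff M 2)\<^sup>2"
        using ulogc_adj[OF ul, of 1] by (simp add: numeral_2_eq_2 numeral_3_eq_3)
      moreover have "2 * coeff M 3 \<le> coeff M 1 * coeff M 3"
      proof (cases "L = 0")
        case True
        then show ?thesis using assms by (simp add: cM binomial_eq_0)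
      next
        case False
        then have "2 \<le> coeff M 1" by (simp add: cM)
        then show ?thesis using nn by (intro mult_right_mono)
      qed
      ultimately have "(coeff M 1 + 1) * coeff M 3 \<le> (coeff M 2)\<^sup>2"
        by (simp add: distrib_right)
      then show ?thesis
        unfolding True c by (simp add: numeral_2_eq_2 numeral_3_eq_3)
    next
      case False
      have "(coeff M (i + 1))\<^sup>2 \<le> (coeff (M + X) (i + 1))\<^sup>2"
        unfolding c using nn by (intro power_mono) auto
      then show ?thesis
        using adj[of i] False unfolding c by auto
    qed
  qed
qed

section \<open>Assembly for double stars and paths\<close>

lemma poly_X1_power_pos: "0 < x \<Longrightarrow> 0 < poly (X * X1 ^ m * (X * X1 ^ n)) x"
  by (simp add: monom_altdef poly_power)

lemma poly_pathpoly_pos: "0 < x \<Longrightarrow> 0 < poly (pathpoly k) x"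
  by (induction k rule: pathpoly.induct) (auto simp: monom_altdef intro!: add_pos_pos)

lemma logc_pathQ:
  assumes "2 \<le> k" "k \<noteq> 3" "k \<noteq> 5" "0 \<le> c" "c \<le> 4"
  shows "logc (pathQ k c)"
proof -
  have "k \<in> {2, 4, 6, 7, 8, 9} \<or> 10 \<le> k" using assms(1-3) by auto
  then show ?thesis using logc_pathQ_small logc_pathQ_large assms(4,5) by blast
qed

text \<open>The hypotheses are symmetric in \<open>l1\<close> and \<open>l2\<close>, so both orders
  of the leaf numbers are covered with \<open>l\<close> the smaller one.\<close>

lemma double_star_seq_le:
  fixes l d n :: nat
  assumes G: "l1 + l2 = l + (l + d)" "X1 ^ l1 + X1 ^ l2 = X1 ^ l + X1 ^ (l + d)"
  shows "log_concave (indep_seq (concatenation n (double_star l1 l2) Center_v Center_w)) \<and>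
    unimodal (indep_seq (concatenation n (double_star l1 l2) Center_v Center_w))"
proof -
  interpret concat_graph "double_star l1 l2" Center_v Center_w
    by standard (auto simp: double_star_def Let_def)
  define g h where "g = X1 ^ (l + (l + d)) + X * (X1 ^ l + X1 ^ (l + d))" and "h = X\<^sup>2 * X1 ^ (l + (l + d))"
  have Q: "g\<^sup>2 - smult c h = X1 ^ (2 * l) * starR (l + d) d c" for c
    unfolding g_def h_def by (rule double_star_factor)
  have X1: "logc X1" using ulogc_X1 by (simp add: ulogc_def)
  have hh: "h = X * X1 ^ l2 * (X * X1 ^ l1)"
    unfolding h_def G(1)[symmetric] by (simp only: power_add power2_eq_square mult_ac)
  have ok: "logc (g\<^sup>2 - smult c h)" if "(l + d, d) \<noteq> (1, 1)" "0 \<le> c" "c \<le> 4" for c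
    unfolding Q using that X1 by (intro logc_mult logc_power logc_starR) auto
  \<comment> \<open>The one star excluded from \<open>logc_starR\<close>; it is handled as a
    path.\<close>
  have ex: "g\<^sup>2 - smult c h = pathQ 3 c" if "l = 0" "d = 1" for c
  proof -
    have "pathpoly 3 = g"
      unfolding g_def that by (simp add: numeral_3_eq_3 monom_altdef one_pCons)
    moreover have "X\<^sup>2 * pathpoly 1 * pathpoly 0 = h"
      unfolding h_def that by simp
    ultimately show ?thesis by (simp add: pathQ_def)
  qed
  have exc: "(l + d, d) \<noteq> (1, 1) \<or> (l = 0 \<and> d = 1)" by auto
  show ?thesis
  proof (rule logc_concatenation[where g = g and h = h])
    show "ipoly (double_star l1 l2) = g"
      unfolding ipoly_double_star g_def G ..
    show "setpoly Iv * setpoly Iw = h"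
      unfolding setpoly_Center_v setpoly_Center_w hh ..
    show "0 < poly h x" if "0 < x" for x
      unfolding hh using that by (rule poly_X1_power_pos)
    have "g = X1 ^ l * (X1 ^ d * (X1 ^ (l + d - d) + X) + X)"
      unfolding g_def add_diff_cancel_right' by (simp only: power_add algebra_simps)
    then show "logc g"
      using logc_star_linear[of d "l + d"] X1 by (simp only:) (intro logc_mult logc_power, auto)
    show "logc (g\<^sup>2 - smult c h)" if "0 \<le> c" "c \<le> 3" for c
      using exc ok[of c] ex[of c] logc_pathQ_3[of c] that by fastforce
    show "logc ((g\<^sup>2 - smult c h) * (g\<^sup>2 - smult e h))"
      if "3 \<le> c" "c \<le> 4" "0 \<le> e" "e \<le> 1" for c e
      using exc
    proof
      assume "(l + d, d) \<noteq> (1, 1)"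
      then show ?thesis using that by (intro logc_mult ok) auto
    next
      assume "l = 0 \<and> d = 1"
      then show ?thesis using that logc_pathQ_3_pair ex by simp
    qed
  qed
qed

lemma double_star_seq:
  "log_concave (indep_seq (concatenation n (double_star l1 l2) Center_v Center_w)) \<and>
    unimodal (indep_seq (concatenation n (double_star l1 l2) Center_v Center_w))"
proof (cases "l1 \<le> l2")
  case True
  then show ?thesis
    by (intro double_star_seq_le[where l = l1 and d = "l2 - l1"]) auto
next
  case False
  then show ?thesis
    by (intro double_star_seq_le[where l = l2 and d = "l1 - l2"]) (auto simp: add.commute)
qed

lemma path_seq:
  assumes k: "2 \<le> k" and w: "is_leaf (path_graph k) w" and vw: "(v, w) \<in> parcs (path_graph k)"
  shows "log_concave (indep_seq (concatenation n (path_graph k) v w)) \<and>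
    unimodal (indep_seq (concatenation n (path_graph k) v w))"
proof -
  interpret concat_graph "path_graph k" v w
    by standard (use vw in \<open>auto simp: path_graph_def Let_def\<close>)
  define h where "h = X * pathpoly (k - 3) * (X * pathpoly (k - 2))"
  have Q: "(pathpoly k)\<^sup>2 - smult c h = pathQ k c" for c
    by (simp add: pathQ_def h_def power2_eq_square mult_ac)
  show ?thesis
  proof (rule logc_concatenation[where g = "pathpoly k" and h = h])
    show "setpoly Iv * setpoly Iw = h"
      by (simp only: h_def setpoly_path_leaf[OF w vw k])
    show "0 < poly h x" if "0 < x" for x
      using that by (simp add: h_def monom_altdef poly_pathpoly_pos)
    show "logc ((pathpoly k)\<^sup>2 - smult c h)" if "0 \<le> c" "c \<le> 3" for c
      unfolding Q using that k logc_pathQ[of k c] logc_pathQ_3 logc_pathQ_5 by fastforce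
    show "logc (((pathpoly k)\<^sup>2 - smult c h) * ((pathpoly k)\<^sup>2 - smult d h))"
      if "3 \<le> c" "c \<le> 4" "0 \<le> d" "d \<le> 1" for c d
    proof (cases "k = 3 \<or> k = 5")
      case True
      then show ?thesis unfolding Q using that logc_pathQ_3_pair logc_pathQ_5_pair by auto
    next
      case False
      then show ?thesis unfolding Q using that k by (intro logc_mult logc_pathQ) auto
    qed
  qed (rule ipoly_path, rule logc_pathpoly)
qed

theorem theorem1p9:
  shows
    "(\<forall>(l1::nat) (l2::nat) (n::nat).
        log_concave (indep_seq (concatenation n (double_star l1 l2) Center_v Center_w)) \<and>
        unimodal (indep_seq (concatenation n (double_star l1 l2) Center_v Center_w)))
     \<and>
     (\<forall>(k::nat) (v::nat) (w::nat) (n::nat).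
        2 \<le> k \<and> k \<le> 5000 \<and> is_leaf (path_graph k) w \<and> (v, w) \<in> parcs (path_graph k) \<longrightarrow>
        log_concave (indep_seq (concatenation n (path_graph k) v w)) \<and>
        unimodal (indep_seq (concatenation n (path_graph k) v w)))"
  using double_star_seq path_seq by blast

end
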